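(* Let $\{w_n\}_{n\ge0}$ be the Walsh system or, more generally, a given Vilenkin system of bounded type on $[0,1)$. Let $f\in L^1[0,1]$ and let $G\subset[0,1]$ be an everywhere dense open set. Then there is a function $g\in L^1[0,1]$ whose Fourier series in the system $\{w_n\}$ converges almost everywhere and such that $\{x: g(x)\neq f(x)\}\subset G$.
   Context: Vilenkin system of bounded type: let $(p_k)_{k\ge1}$ be a bounded sequence of integers $p_k\ge2$, and put $P_0=1$, $P_k=p_1p_2\cdots p_k$. Each $x\in[0,1)$ is written as $x=\sum_{k\ge1}x_k/P_k$ with $x_k\in\{0,\ldots,p_k-1\}$ (the finite expansion being chosen when there are two), and each integer $n\ge0$ as $n=\sum_{k\ge1}n_kP_{k-1}$ with $n_k\in\{0,\ldots,p_k-1\}$. Then $w_n(x)=\exp\big(2\pi i\sum_{k\ge1}n_kx_k/p_k\big)$. The Walsh system (in Paley order) is the case $p_k=2$ for all $k$. The Fourier series of $g\in L^1[0,1]$ is $\sum_{n\ge0}a_n(g)w_n(x)$ with $a_n(g)=\int_0^1 g\,\overline{w_n}$, and convergence means convergence of the partial sums $\sum_{n=0}^{m-1}a_n(g)w_n(x)$ as $m\to\infty$. *)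

theory Defs
  imports "HOL-Analysis.Analysis"
begin

definition bounded_type :: "(nat \<Rightarrow> nat) \<Rightarrow> bool" where
  "bounded_type p \<longleftrightarrow> (\<forall>k\<ge>1. 2 \<le> p k) \<and> (\<exists>B. \<forall>k\<ge>1. p k \<le> B)"

definition vprod :: "(nat \<Rightarrow> nat) \<Rightarrow> nat \<Rightarrow> nat" where
  "vprod p k = (\<Prod>j=1..k. p j)"

text \<open>Digit sequences are indexed from 1; the entries \<open>p 0\<close> and \<open>d 0\<close> play no role, and
  \<open>d 0 = 0\<close> is only a normalisation that makes the sequences unique.\<close>

definition is_digits :: "(nat \<Rightarrow> nat) \<Rightarrow> (nat \<Rightarrow> nat) \<Rightarrow> bool" where
  "is_digits p d \<longleftrightarrow> d 0 = 0 \<and> (\<forall>k\<ge>1. d k < p k)"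

definition frac_expansion :: "(nat \<Rightarrow> nat) \<Rightarrow> real \<Rightarrow> (nat \<Rightarrow> nat) \<Rightarrow> bool" where
  "frac_expansion p x d \<longleftrightarrow>
     is_digits p d \<and> (\<lambda>k. real (d (Suc k)) / real (vprod p (Suc k))) sums x"

definition frac_digits :: "(nat \<Rightarrow> nat) \<Rightarrow> real \<Rightarrow> nat \<Rightarrow> nat" where
  "frac_digits p x = (THE d. frac_expansion p x d \<and>
     ((\<exists>d'. frac_expansion p x d' \<and> d' \<noteq> d) \<longrightarrow> finite {k. d k \<noteq> 0}))"

definition nat_expansion :: "(nat \<Rightarrow> nat) \<Rightarrow> nat \<Rightarrow> (nat \<Rightarrow> nat) \<Rightarrow> bool" where
  "nat_expansion p n d \<longleftrightarrow>
     is_digits p d \<and> finite {k. d k \<noteq> 0} \<and> n = (\<Sum>k | d k \<noteq> 0. d k * vprod p (k - 1))"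

definition nat_digits :: "(nat \<Rightarrow> nat) \<Rightarrow> nat \<Rightarrow> nat \<Rightarrow> nat" where
  "nat_digits p n = (THE d. nat_expansion p n d)"

text \<open>The series in the exponent has only finitely many nonzero terms.\<close>

definition vilenkin :: "(nat \<Rightarrow> nat) \<Rightarrow> nat \<Rightarrow> real \<Rightarrow> complex" where
  "vilenkin p n x = exp (2 * of_real pi * \<i> * of_real
     (\<Sum>k. real (nat_digits p n (Suc k)) * real (frac_digits p x (Suc k)) / real (p (Suc k))))"

definition vilenkin_coeff :: "(nat \<Rightarrow> nat) \<Rightarrow> (real \<Rightarrow> complex) \<Rightarrow> nat \<Rightarrow> complex" where
  "vilenkin_coeff p g n = (LINT x|lebesgue_on {0..1}. g x * cnj (vilenkin p n x))"

definition vilenkin_partial_sum ::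
    "(nat \<Rightarrow> nat) \<Rightarrow> (real \<Rightarrow> complex) \<Rightarrow> nat \<Rightarrow> real \<Rightarrow> complex" where
  "vilenkin_partial_sum p g m x = (\<Sum>n<m. vilenkin_coeff p g n * vilenkin p n x)"

lemma vprod_0 [simp]: "vprod p 0 = 1"
  and vprod_Suc: "vprod p (Suc k) = vprod p k * p (Suc k)"
  by (simp_all add: vprod_def)

text \<open>The digits are well defined and given by the usual closed formulas.\<close>

context
  fixes p :: "nat \<Rightarrow> nat"
  assumes p2: "\<And>k. k \<ge> 1 \<Longrightarrow> 2 \<le> p k"
begin

lemma p_pos: "1 \<le> k \<Longrightarrow> 0 < p k"
  using p2[of k] by linarith

lemma vprod_ge: "2 ^ k \<le> vprod p k"
proof (induction k)
  case (Suc k)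
  have "2 ^ k * 2 \<le> vprod p k * p (Suc k)"
    using Suc p2[of "Suc k"] by (intro mult_mono) auto
  then show ?case by (simp add: vprod_Suc)
qed simp

lemma vprod_pos: "0 < vprod p k"
  using vprod_ge[of k] by (meson less_le_trans zero_less_numeral zero_less_power)

lemma vprod_gt: "k < vprod p k"
  using vprod_ge[of k] less_exp[of k] by linarith

lemma nat_partial:
  "(\<Sum>k=1..m. (n div vprod p (k - 1) mod p k) * vprod p (k - 1)) = n mod vprod p m"
proof (induction m)
  case (Suc m)
  then show ?case by (simp add: vprod_Suc mod_mult2_eq)
qed simp

lemma is_digits_partial_less:
  assumes "is_digits p d"
  shows "(\<Sum>k=1..m. d k * vprod p (k - 1)) < vprod p m"
proof (induction m)
  case (Suc m)
  have "Suc (d (Suc m)) * vprod p m \<le> p (Suc m) * vprod p m"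
    using assms by (intro mult_right_mono) (auto simp: is_digits_def Suc_le_eq)
  then show ?case using Suc by (simp add: vprod_Suc algebra_simps)
qed simp

lemma nat_expansion_formula:
  "nat_expansion p n (\<lambda>k. if k = 0 then 0 else n div vprod p (k - 1) mod p k)"
    (is "nat_expansion p n ?d")
proof -
  have z: "?d k = 0" if "k > Suc n" for k
    using vprod_gt[of "k - 1"] that by (auto simp: div_less)
  have sub: "{k. ?d k \<noteq> 0} \<subseteq> {1..Suc n}"
  proof
    fix k assume "k \<in> {k. ?d k \<noteq> 0}"
    then have "?d k \<noteq> 0" by blast
    moreover from this z have "\<not> k > Suc n" by (rule contrapos_nn)
    moreover have "k \<noteq> 0" using \<open>?d k \<noteq> 0\<close> by (cases "k = 0") simp_all
    ultimately show "k \<in> {1..Suc n}" by auto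
  qed
  have "(\<Sum>k | ?d k \<noteq> 0. ?d k * vprod p (k - 1)) = (\<Sum>k=1..Suc n. ?d k * vprod p (k - 1))"
    using sub by (intro sum.mono_neutral_left) auto
  also have "\<dots> = (\<Sum>k=1..Suc n. (n div vprod p (k - 1) mod p k) * vprod p (k - 1))"
    by (intro sum.cong) auto
  also have "\<dots> = n"
    unfolding nat_partial using vprod_gt[of "Suc n"] by simp
  finally have "n = (\<Sum>k | ?d k \<noteq> 0. ?d k * vprod p (k - 1))" ..
  moreover have "is_digits p ?d"
    unfolding is_digits_def by (simp add: p_pos)
  ultimately show ?thesis
    unfolding nat_expansion_def using finite_subset[OF sub] by blast
qed

lemma nat_expansion_unique:
  assumes "nat_expansion p n d"
  shows "d = (\<lambda>k. if k = 0 then 0 else n div vprod p (k - 1) mod p k)"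
proof -
  have dig: "is_digits p d" and fin: "finite {k. d k \<noteq> 0}"
    and n: "n = (\<Sum>k | d k \<noteq> 0. d k * vprod p (k - 1))"
    using assms by (auto simp: nat_expansion_def)
  have d0: "d 0 = 0" using dig by (simp add: is_digits_def)
  obtain N where N: "\<And>k. d k \<noteq> 0 \<Longrightarrow> k \<le> N"
    using fin by (metis (mono_tags, lifting) finite_nat_set_iff_bounded_le mem_Collect_eq)
  have n': "n = (\<Sum>k=1..M. d k * vprod p (k - 1))" if "M \<ge> N" for M
    unfolding n
  proof (intro sum.mono_neutral_left)
    show "{k. d k \<noteq> 0} \<subseteq> {1..M}"
    proof
      fix k assume "k \<in> {k. d k \<noteq> 0}"
      then have "d k \<noteq> 0" by simp
      then show "k \<in> {1..M}" using N[of k] d0 that by (cases k) auto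
    qed
  qed auto
  have dvd: "vprod p m dvd (\<Sum>k=Suc m..m + j. d k * vprod p (k - 1))" for m j
  proof (intro dvd_sum dvd_mult)
    fix k assume "k \<in> {Suc m..m + j}"
    then have "{1..m} \<subseteq> {1..k - 1}" by auto
    then show "vprod p m dvd vprod p (k - 1)"
      unfolding vprod_def by (intro prod_dvd_prod_subset) auto
  qed
  have md: "n mod vprod p m = (\<Sum>k=1..m. d k * vprod p (k - 1))" for m
  proof -
    have "n = (\<Sum>k=1..m + N. d k * vprod p (k - 1))" by (rule n') simp
    also have "\<dots> = (\<Sum>k=1..m. d k * vprod p (k - 1)) + (\<Sum>k=Suc m..m + N. d k * vprod p (k - 1))"
      using sum.ub_add_nat[of 1 m "\<lambda>k. d k * vprod p (k - 1)" N] by simp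
    finally have eq: "n = (\<Sum>k=1..m. d k * vprod p (k - 1)) + (\<Sum>k=Suc m..m + N. d k * vprod p (k - 1))" .
    obtain c where "(\<Sum>k=Suc m..m + N. d k * vprod p (k - 1)) = vprod p m * c"
      using dvd[of m N] by (rule dvdE)
    then have "n mod vprod p m = (\<Sum>k=1..m. d k * vprod p (k - 1)) mod vprod p m"
      by (subst eq) (simp only: mod_mult_self2)
    then show ?thesis using is_digits_partial_less[OF dig, of m] by simp
  qed
  show ?thesis
  proof
    fix k
    show "d k = (if k = 0 then 0 else n div vprod p (k - 1) mod p k)"
    proof (cases k)
      case (Suc m)
      have "d (Suc m) * vprod p m = (n div vprod p m mod p (Suc m)) * vprod p m"
        using md[of "Suc m"] md[of m] by (auto simp: vprod_Suc mod_mult2_eq)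
      then show ?thesis using vprod_pos[of m] Suc by simp
    qed (use d0 in simp)
  qed
qed

lemma nat_digits_formula:
  "k \<ge> 1 \<Longrightarrow> nat_digits p n k = n div vprod p (k - 1) mod p k"
  and nat_expansion_nat_digits: "nat_expansion p n (nat_digits p n)"
proof -
  have *: "nat_digits p n = (\<lambda>k. if k = 0 then 0 else n div vprod p (k - 1) mod p k)"
    unfolding nat_digits_def
    by (rule the_equality[where P = "nat_expansion p n", OF nat_expansion_formula nat_expansion_unique])
  show "k \<ge> 1 \<Longrightarrow> nat_digits p n k = n div vprod p (k - 1) mod p k" by (simp add: *)
  show "nat_expansion p n (nat_digits p n)" unfolding * by (rule nat_expansion_formula)
qed

lemma floor_vprod_Suc:
  fixes x :: real
  assumes "0 \<le> x"
  shows "nat \<lfloor>x * vprod p (Suc m)\<rfloor> div p (Suc m) = nat \<lfloor>x * vprod p m\<rfloor>"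
proof -
  have "\<lfloor>x * vprod p (Suc m) / real (p (Suc m))\<rfloor> = \<lfloor>x * vprod p (Suc m)\<rfloor> div int (p (Suc m))"
    using floor_divide_real_eq_div[of "int (p (Suc m))" "x * vprod p (Suc m)"] by simp
  moreover have "x * vprod p (Suc m) / real (p (Suc m)) = x * vprod p m"
    using p2[of "Suc m"] by (simp add: vprod_Suc)
  ultimately show ?thesis using assms by (simp add: nat_div_distrib)
qed

lemma real_partial:
  fixes x :: real
  assumes "0 \<le> x" "x < 1"
  shows "(\<Sum>k<m. real (nat \<lfloor>x * vprod p (Suc k)\<rfloor> mod p (Suc k)) / vprod p (Suc k))
     = real (nat \<lfloor>x * vprod p m\<rfloor>) / vprod p m"
proof (induction m)
  case 0
  have "\<lfloor>x\<rfloor> = 0" using assms by linarith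
  then show ?case by simp
next
  case (Suc m)
  let ?a = "nat \<lfloor>x * vprod p (Suc m)\<rfloor>"
  have "real ?a = real (?a div p (Suc m)) * p (Suc m) + real (?a mod p (Suc m))"
    by (metis div_mult_mod_eq of_nat_add of_nat_mult)
  then have "real ?a / vprod p (Suc m)
      = real (?a div p (Suc m)) * p (Suc m) / vprod p (Suc m) + real (?a mod p (Suc m)) / vprod p (Suc m)"
    by (simp add: add_divide_distrib)
  also have "real (?a div p (Suc m)) * p (Suc m) / vprod p (Suc m) = real (?a div p (Suc m)) / vprod p m"
    using p2[of "Suc m"] by (simp add: vprod_Suc)
  finally show ?case using Suc floor_vprod_Suc[OF assms(1), of m] by simp
qed

lemma frac_expansion_formula:
  fixes x :: real
  assumes "0 \<le> x" "x < 1"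
  shows "frac_expansion p x (\<lambda>k. if k = 0 then 0 else nat \<lfloor>x * vprod p k\<rfloor> mod p k)"
    (is "frac_expansion p x ?d")
proof -
  have "is_digits p ?d"
    unfolding is_digits_def by (simp add: p_pos)
  moreover have "(\<lambda>k. real (?d (Suc k)) / real (vprod p (Suc k))) sums x"
  proof -
    have "(\<lambda>m. real (nat \<lfloor>x * vprod p m\<rfloor>) / vprod p m) \<longlonglongrightarrow> x"
    proof (rule tendsto_sandwich)
      show "\<forall>\<^sub>F m in sequentially. x - 1 / 2 ^ m \<le> real (nat \<lfloor>x * vprod p m\<rfloor>) / vprod p m"
      proof (intro always_eventually allI)
        fix m
        have "x * vprod p m - 1 \<le> real (nat \<lfloor>x * vprod p m\<rfloor>)" using assms by linarith
        then have "(x * vprod p m - 1) / vprod p m \<le> real (nat \<lfloor>x * vprod p m\<rfloor>) / vprod p m"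
          by (intro divide_right_mono) auto
        moreover have "(x * vprod p m - 1) / vprod p m = x - 1 / vprod p m"
          using vprod_pos[of m] by (simp add: field_simps)
        moreover have "real (2 ^ m) \<le> real (vprod p m)" using vprod_ge[of m] of_nat_le_iff by blast
        then have "1 / real (vprod p m) \<le> 1 / 2 ^ m" by (intro divide_left_mono) (use vprod_pos[of m] in auto)
        ultimately show "x - 1 / 2 ^ m \<le> real (nat \<lfloor>x * vprod p m\<rfloor>) / vprod p m" by linarith
      qed
      show "\<forall>\<^sub>F m in sequentially. real (nat \<lfloor>x * vprod p m\<rfloor>) / vprod p m \<le> x"
      proof (intro always_eventually allI)
        fix m
        have "0 \<le> x * vprod p m" using assms by simp
        then have "real (nat \<lfloor>x * vprod p m\<rfloor>) \<le> x * vprod p m" by linarith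
        then show "real (nat \<lfloor>x * vprod p m\<rfloor>) / vprod p m \<le> x"
          using vprod_pos[of m] by (simp add: divide_le_eq)
      qed
      have "(\<lambda>m. x - (1/2) ^ m) \<longlonglongrightarrow> x - 0"
        by (intro tendsto_intros LIMSEQ_power_zero) auto
      then show "(\<lambda>m. x - 1 / 2 ^ m) \<longlonglongrightarrow> x" by (simp add: power_one_over)
    qed auto
    then show ?thesis unfolding sums_def using real_partial[OF assms] by simp
  qed
  ultimately show ?thesis unfolding frac_expansion_def by blast
qed

lemma frac_expansion_tail:
  fixes T :: "nat \<Rightarrow> real"
  assumes "frac_expansion p x d"
  defines "T \<equiv> \<lambda>m. real (vprod p m) * (x - (\<Sum>k<m. real (d (Suc k)) / vprod p (Suc k)))"
  shows "0 \<le> T m" "T m \<le> 1" "T (Suc m) = p (Suc m) * T m - d (Suc m)"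
proof -
  define S where "S m = (\<Sum>k<m. real (d (Suc k)) / vprod p (Suc k))" for m
  have S_eq: "S = (\<lambda>m. \<Sum>k<m. real (d (Suc k)) / vprod p (Suc k))"
    by (rule ext) (rule S_def)
  have lim: "S \<longlonglongrightarrow> x" and dig: "\<And>k. k \<ge> 1 \<Longrightarrow> d k < p k"
    using assms(1) by (auto simp: frac_expansion_def sums_def S_eq is_digits_def)
  have mono: "S m \<le> S (m + j)" for j
  proof (induction j)
    case (Suc j)
    have "0 \<le> real (d (Suc (m + j))) / vprod p (Suc (m + j))" by simp
    moreover have "S (m + Suc j) = S (m + j) + real (d (Suc (m + j))) / vprod p (Suc (m + j))"
      by (simp add: S_def)
    ultimately show ?case using Suc by linarith
  qed simp
  have up: "S (m + j) \<le> S m + 1 / vprod p m - 1 / vprod p (m + j)" for j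
  proof (induction j)
    case (Suc j)
    let ?q = "real (p (Suc (m + j)))" and ?P = "real (vprod p (m + j))"
    have "real (d (Suc (m + j))) \<le> ?q - 1"
      using dig[of "Suc (m + j)"] by linarith
    then have "real (d (Suc (m + j))) / (?P * ?q) \<le> (?q - 1) / (?P * ?q)"
      by (intro divide_right_mono) auto
    also have "\<dots> = 1 / ?P - 1 / (?P * ?q)"
      using p2[of "Suc (m + j)"] vprod_pos[of "m + j"] by (simp add: field_simps)
    finally show ?case using Suc by (simp add: S_def vprod_Suc)
  qed simp
  have lim': "(\<lambda>j. S (m + j)) \<longlonglongrightarrow> x"
    using LIMSEQ_ignore_initial_segment[OF lim, of m] by (simp add: add.commute)
  have "S m \<le> x" by (rule LIMSEQ_le_const[OF lim']) (use mono in auto)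
  then show "0 \<le> T m" by (simp add: T_def S_def)
  have "S (m + j) \<le> S m + 1 / vprod p m" for j
    by (rule order_trans[OF up]) simp
  then have "x \<le> S m + 1 / vprod p m"
    by (intro LIMSEQ_le_const2[OF lim']) auto
  then have "real (vprod p m) * (x - S m) \<le> real (vprod p m) * (1 / vprod p m)"
    by (intro mult_left_mono) auto
  then show "T m \<le> 1" using vprod_pos[of m] by (simp add: T_def S_def)
  show "T (Suc m) = p (Suc m) * T m - d (Suc m)"
    using vprod_pos[of m] p2[of "Suc m"] by (simp add: T_def vprod_Suc field_simps)
qed

text \<open>An expansion other than the greedy one has all its digits maximal from some point on,
  and exists only if the greedy one is finite.\<close>

lemma frac_expansion_other:
  fixes x :: real
  assumes x: "0 \<le> x" "x < 1" and d: "frac_expansion p x d"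
    and ne: "d \<noteq> (\<lambda>k. if k = 0 then 0 else nat \<lfloor>x * vprod p k\<rfloor> mod p k)"
  shows "infinite {k. d k \<noteq> 0}"
    and "finite {k. (if k = 0 then 0 else nat \<lfloor>x * vprod p k\<rfloor> mod p k) \<noteq> 0}"
proof -
  define T where "T m = real (vprod p m) * (x - (\<Sum>k<m. real (d (Suc k)) / vprod p (Suc k)))" for m
  note tl = frac_expansion_tail[OF d, folded T_def]
  have d0: "d 0 = 0" and dig: "\<And>k. k \<ge> 1 \<Longrightarrow> d k < p k"
    using d by (auto simp: frac_expansion_def is_digits_def)
  have int: "\<exists>a::nat. x * vprod p m = T m + real a \<and> (\<forall>j. m = Suc j \<longrightarrow> a mod p m = d m)" for m
  proof (induction m)
    case 0
    then show ?case by (intro exI[of _ 0]) (simp add: T_def)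
  next
    case (Suc m)
    then obtain a where a: "x * vprod p m = T m + real a" by blast
    have "x * vprod p (Suc m) = (T m + real a) * p (Suc m)"
      unfolding a[symmetric] by (simp add: vprod_Suc)
    also have "\<dots> = T (Suc m) + real (a * p (Suc m) + d (Suc m))"
      using tl(3)[of m] by (simp add: algebra_simps)
    finally show ?case
      using dig[of "Suc m"] by (intro exI[of _ "a * p (Suc m) + d (Suc m)"]) simp
  qed
  have "\<exists>m. T m = 1"
  proof (rule ccontr)
    assume "\<nexists>m. T m = 1"
    then have lt: "T m < 1" for m using tl(2)[of m] by (metis less_eq_real_def)
    have "d k = nat \<lfloor>x * vprod p k\<rfloor> mod p k" if k: "k \<noteq> 0" for k
    proof -
      obtain a where a: "x * vprod p k = T k + real a" "a mod p k = d k"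
        using int[of k] k by (metis not0_implies_Suc)
      have "\<lfloor>x * vprod p k\<rfloor> = int a"
        unfolding a(1) using lt[of k] tl(1)[of k] by linarith
      then show ?thesis using a(2) by simp
    qed
    then have "d k = (if k = 0 then 0 else nat \<lfloor>x * vprod p k\<rfloor> mod p k)" for k
      using d0 by (cases "k = 0") simp_all
    then have "d = (\<lambda>k. if k = 0 then 0 else nat \<lfloor>x * vprod p k\<rfloor> mod p k)" by (rule ext)
    with ne show False by contradiction
  qed
  then obtain m where m: "T m = 1" by blast
  have Tm: "T (m + j) = 1 \<and> d (Suc (m + j)) \<noteq> 0" for j
  proof -
    have step: "d (Suc i) \<noteq> 0 \<and> T (Suc i) = 1" if "T i = 1" for i
    proof -
      have "real (d (Suc i)) + 1 \<le> p (Suc i)" using dig[of "Suc i"] by linarith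
      moreover have "T (Suc i) = p (Suc i) - real (d (Suc i))" using tl(3)[of i] that by simp
      moreover have "real (p (Suc i)) \<ge> 2" using p2[of "Suc i"] by simp
      ultimately show ?thesis using tl(2)[of "Suc i"] by (auto intro: antisym)
    qed
    have "T (m + j) = 1" using m step by (induction j) auto
    then show ?thesis using step by blast
  qed
  have "Suc (m + j) \<in> {k. d k \<noteq> 0}" for j using Tm by blast
  then have "\<exists>k>N. k \<in> {k. d k \<noteq> 0}" for N
    by (metis add.commute le_add1 le_imp_less_Suc)
  then show "infinite {k. d k \<noteq> 0}" using infinite_nat_iff_unbounded by blast
  have z: "nat \<lfloor>x * vprod p (Suc (m + j))\<rfloor> mod p (Suc (m + j)) = 0" for j
  proof -
    obtain a where a: "x * vprod p (m + j) = T (m + j) + real a" using int by blast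
    have "x * vprod p (Suc (m + j)) = x * vprod p (m + j) * p (Suc (m + j))"
      by (simp add: vprod_Suc)
    also have "\<dots> = real (Suc a * p (Suc (m + j)))"
      using a Tm[of j] by (simp add: algebra_simps)
    finally show ?thesis by (metis floor_of_nat mod_mult_self2_is_0 nat_int)
  qed
  have "{k. (if k = 0 then 0 else nat \<lfloor>x * vprod p k\<rfloor> mod p k) \<noteq> 0} \<subseteq> {..m}"
  proof
    fix k assume k: "k \<in> {k. (if k = 0 then 0 else nat \<lfloor>x * vprod p k\<rfloor> mod p k) \<noteq> 0}"
    show "k \<in> {..m}"
    proof (rule ccontr)
      assume "k \<notin> {..m}"
      then obtain j where "k = Suc (m + j)" by (metis atMost_iff less_imp_Suc_add not_le)
      then show False using k z[of j] by simp
    qed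
  qed
  then show "finite {k. (if k = 0 then 0 else nat \<lfloor>x * vprod p k\<rfloor> mod p k) \<noteq> 0}"
    using finite_subset by blast
qed

lemma frac_digits_formula:
  fixes x :: real
  assumes "0 \<le> x" "x < 1"
  shows "k \<ge> 1 \<Longrightarrow> frac_digits p x k = nat \<lfloor>x * vprod p k\<rfloor> mod p k"
    and frac_expansion_frac_digits: "frac_expansion p x (frac_digits p x)"
proof -
  have *: "frac_digits p x = (\<lambda>k. if k = 0 then 0 else nat \<lfloor>x * vprod p k\<rfloor> mod p k)"
    (is "_ = ?g")
    unfolding frac_digits_def
  proof (rule the_equality)
    show "frac_expansion p x ?g \<and> ((\<exists>d'. frac_expansion p x d' \<and> d' \<noteq> ?g) \<longrightarrow> finite {k. ?g k \<noteq> 0})"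
      using frac_expansion_formula frac_expansion_other(2) assms by blast
  next
    fix d assume d: "frac_expansion p x d \<and>
      ((\<exists>d'. frac_expansion p x d' \<and> d' \<noteq> d) \<longrightarrow> finite {k. d k \<noteq> 0})"
    show "d = ?g"
    proof (rule ccontr)
      assume "d \<noteq> ?g"
      then show False
        using d frac_expansion_formula[OF assms(1,2)] frac_expansion_other(1)[OF assms(1,2)] by metis
    qed
  qed
  show "k \<ge> 1 \<Longrightarrow> frac_digits p x k = nat \<lfloor>x * vprod p k\<rfloor> mod p k" by (simp add: *)
  show "frac_expansion p x (frac_digits p x)"
    unfolding * using frac_expansion_formula assms by blast
qed

end

end

theory Submission imports Defs begin

text \<open>Write \<open>f\<close> as \<open>s\<^sub>0 + \<Sum>\<^sub>k h\<^sub>k\<close> with step functions \<open>h\<^sub>k\<close> that are constant on cylinders and very small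
  in \<open>L\<^sup>1\<close>, and replace each \<open>h\<^sub>k\<close> by a step function that agrees with it off \<open>G\<close>, has comparable
  \<open>L\<^sup>1\<close>-norm, and whose partial sums are all at most \<open>2\<^sup>-\<^sup>k\<close> off a set of measure \<open>2\<^sup>-\<^sup>k\<close>.

  The basic operation takes a function that is constant on the cylinders of some rank, and
  in every such cylinder subtracts its whole mass on one much smaller subcylinder. This kills all low
  frequencies, so treating the cylinders of \<open>h\<^sub>k\<close> one after the other, with rapidly
  increasing ranks, places the pieces in disjoint frequency blocks, and
  the maximal partial sum is controlled by that of single pieces. The operation is used twice.
  Where \<open>h\<^sub>k\<close> is small in absolute value, the subcylinders are placed periodically; the
  partial sums are then trivially small everywhere, but the function has changed on a set of small measure
  unrelated to \<open>G\<close>. The error made there, together with the large values of \<open>h\<^sub>k\<close>, lives on a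
  set of small measure, so it may be corrected with arbitrarily placed subcylinders inside \<open>G\<close>:
  only the behaviour off the support matters, and there the bound \<open>\<bar>D\<^sub>m(x, y)\<bar> \<le> P\<^sub>k\<close>,
  valid when \<open>x\<close> and \<open>y\<close> lie in different cylinders of rank \<open>k\<close>, gives a weak type estimate.\<close>

section \<open>Splitting sums into blocks, and orthogonality of roots of unity\<close>

lemma sum_lessThan_add: "(\<Sum>n<m + (k::nat). f n) = (\<Sum>n<m. f n) + (\<Sum>r<k. f (r + m) :: 'a :: comm_monoid_add)"
  by (induction k) (simp_all add: ac_simps)

lemma sum_lessThan_blocks: "(\<Sum>n<a * (k::nat). f n) = (\<Sum>b<a. \<Sum>r<k. f (r + b * k) :: 'a :: comm_monoid_add)"
proof (induction a)
  case (Suc a)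
  have "(\<Sum>n<Suc a * k. f n) = (\<Sum>n<a * k + k. f n)" by (simp add: add.commute)
  then show ?case using Suc by (simp only: sum_lessThan_add sum.lessThan_Suc)
qed simp

text \<open>The summand is \<open>z ^ b\<close> for a \<open>q\<close>-th root of unity
  \<open>z\<close>, so the sum is geometric. It vanishes unless \<open>z = 1\<close>, that is,
  unless \<open>q\<close> divides \<open>s - t\<close>, and both indices are below
  \<open>q\<close>.\<close>

lemma roots_of_unity_orthogonal:
  fixes q s t :: nat
  assumes "s < q" "t < q"
  shows "(\<Sum>b<q. exp (2 * of_real pi * \<i> * of_real (real b * real s / real q)) *
      cnj (exp (2 * of_real pi * \<i> * of_real (real b * real t / real q)))) = (if s = t then of_nat q else (0 :: complex))"
proof -
  define z where "z = exp (2 * of_real pi * \<i> * of_real ((real s - real t) / real q))"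
  have q: "real q \<noteq> 0" using assms by simp
  have pow: "exp (2 * of_real pi * \<i> * of_real (real b * real s / real q)) *
      cnj (exp (2 * of_real pi * \<i> * of_real (real b * real t / real q))) = z ^ b" for b
    unfolding z_def exp_of_nat_mult[symmetric] exp_cnj exp_add[symmetric]
    by (rule arg_cong[where f = exp]) (use q in \<open>simp add: field_simps\<close>)
  have zq: "z ^ q = 1"
  proof -
    have "z ^ q = exp (2 * of_real pi * \<i> * of_real (real s - real t))"
      unfolding z_def exp_of_nat_mult[symmetric] by (rule arg_cong[where f = exp]) (use q in \<open>simp add: field_simps\<close>)
    also have "\<dots> = 1"
      unfolding exp_eq_1 by (auto intro!: exI[of _ "int s - int t"])
    finally show ?thesis .
  qed
  show ?thesis
  proof (cases "s = t")
    case True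
    then have "z = 1" by (simp add: z_def)
    then show ?thesis using True unfolding pow by simp
  next
    case False
    have "z \<noteq> 1"
    proof
      assume "z = 1"
      then obtain n :: int where "2 * pi * ((real s - real t) / real q) = of_int (2 * n) * pi"
        unfolding z_def exp_eq_1 by auto
      then have "2 * pi * ((real s - real t) / real q) = 2 * pi * of_int n" by simp
      then have "(real s - real t) / real q = of_int n" by (subst (asm) mult_cancel_left) simp
      then have "real s - real t = of_int n * real q" using q by (simp add: field_simps)
      then have n: "int s - int t = n * int q" by (metis of_int_diff of_int_eq_iff of_int_mult of_int_of_nat_eq)
      have "\<bar>int s - int t\<bar> < int q" using assms by linarith
      then have "\<bar>n\<bar> * int q < 1 * int q" unfolding n by (simp add: abs_mult)
      then have "n = 0" using assms by (simp add: mult_less_cancel_right)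
      then show False using n False by simp
    qed
    then show ?thesis using zq False unfolding pow by (simp add: sum_gp_strict)
  qed
qed

text \<open>The bound \<open>B\<close> is a named parameter because it enters the estimates: the
  weak type bound costs a factor \<open>B\<close>, the periodic correction a factor
  \<open>B ^ q\<close>.\<close>

locale vilenkin_system =
  fixes p :: "nat \<Rightarrow> nat" and B :: nat
  assumes p_ge_2: "\<And>k. k \<ge> 1 \<Longrightarrow> 2 \<le> p k"
    and p_le_B: "\<And>k. k \<ge> 1 \<Longrightarrow> p k \<le> B"
begin

abbreviation P :: "nat \<Rightarrow> nat" where "P \<equiv> vprod p"
abbreviation w :: "nat \<Rightarrow> real \<Rightarrow> complex" where "w \<equiv> vilenkin p"
abbreviation S :: "(real \<Rightarrow> complex) \<Rightarrow> nat \<Rightarrow> real \<Rightarrow> complex" where "S \<equiv> vilenkin_partial_sum p"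
abbreviation coeff :: "(real \<Rightarrow> complex) \<Rightarrow> nat \<Rightarrow> complex" where "coeff \<equiv> vilenkin_coeff p"
abbreviation M :: "real measure" where "M \<equiv> lebesgue_on {0..1}"

subsection \<open>Cylinders and step functions\<close>

lemma P_pos [simp]: "0 < P k"
  by (rule vprod_pos[OF p_ge_2])

lemma P_nonzero [simp]: "P k \<noteq> 0"
  using P_pos[of k] by linarith

lemma P_mono: "n \<le> N \<Longrightarrow> P n \<le> P N"
proof (induction N rule: dec_induct)
  case (step N)
  have "P N * 1 \<le> P N * p (Suc N)" using p_ge_2[of "Suc N"] by (intro mult_left_mono) auto
  then show ?case using step.IH by (metis le_trans mult.right_neutral vprod_Suc)
qed simp

text \<open>\<open>R\<close> counts the subcylinders of rank \<open>n + q\<close> in a cylinder of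
  rank \<open>n\<close>. Later the lower bound makes one subcylinder a small part of its cylinder,
  and the upper bound limits the number of frequency blocks created.\<close>

lemma P_factor: obtains R where "P (n + q) = P n * R" "2 ^ q \<le> R" "R \<le> B ^ q"
proof (induction q arbitrary: thesis)
  case 0
  show ?case by (rule 0[of 1]) auto
next
  case (Suc q)
  obtain R where R: "P (n + q) = P n * R" "2 ^ q \<le> R" "R \<le> B ^ q" using Suc.IH by blast
  have "2 ^ q * 2 \<le> R * p (Suc (n + q))" "R * p (Suc (n + q)) \<le> B ^ q * B"
    using R p_ge_2[of "Suc (n + q)"] p_le_B[of "Suc (n + q)"] by (auto intro!: mult_mono)
  then show ?case using R(1) by (intro Suc.prems[of "R * p (Suc (n + q))"]) (auto simp: vprod_Suc mult.commute)
qed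

lemma P_dvd: "n \<le> N \<Longrightarrow> P n dvd P N"
  using P_factor[of n "N - n"] by (metis dvd_triv_left le_add_diff_inverse)

text \<open>For \<open>x\<close> in [0,1) these are the first \<open>n\<close> digits of
  \<open>x\<close> packed into one integer, the number of the cylinder of rank \<open>n\<close> that
  contains \<open>x\<close>.\<close>

definition idx :: "nat \<Rightarrow> real \<Rightarrow> nat" where "idx n x = nat \<lfloor>x * P n\<rfloor>"

definition cyl :: "nat \<Rightarrow> nat \<Rightarrow> real set" where
  "cyl n i = {real i / P n ..< (real i + 1) / P n}"

lemma idx_eq_iff: "0 \<le> x \<Longrightarrow> idx n x = i \<longleftrightarrow> x \<in> cyl n i"
proof -
  assume x: "0 \<le> x"
  have "0 \<le> x * P n" using x by simp
  then have "idx n x = i \<longleftrightarrow> \<lfloor>x * P n\<rfloor> = int i"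
    unfolding idx_def by linarith
  also have "\<dots> \<longleftrightarrow> real i \<le> x * P n \<and> x * P n < real i + 1" by (simp add: floor_eq_iff)
  also have "\<dots> \<longleftrightarrow> x \<in> cyl n i" by (auto simp: cyl_def field_simps)
  finally show ?thesis .
qed

lemma idx_less: "x \<in> {0..<1} \<Longrightarrow> idx n x < P n"
proof -
  assume x: "x \<in> {0..<1}"
  then have "x * real (P n) < real (P n)" by simp
  then show ?thesis unfolding idx_def using x by (simp add: nat_less_iff floor_less_iff)
qed

lemma cyl_nonneg: "x \<in> cyl n i \<Longrightarrow> 0 \<le> x"
  unfolding cyl_def by (metis atLeastLessThan_iff divide_nonneg_nonneg of_nat_0_le_iff order_trans)

lemma cyl_subset: "i < P n \<Longrightarrow> cyl n i \<subseteq> {0..<1}"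
proof
  fix x assume i: "i < P n" and x: "x \<in> cyl n i"
  have "(real i + 1) / P n \<le> 1" using i by (simp add: divide_le_eq)
  moreover have "x < (real i + 1) / P n" using x unfolding cyl_def by simp
  ultimately have "x < 1" by (rule order_less_le_trans[rotated])
  then show "x \<in> {0..<1}" using cyl_nonneg[OF x] by simp
qed

lemma left_end_cyl: "real i / P n \<in> cyl n i"
  by (simp add: cyl_def divide_strict_right_mono)

lemma left_end_mem: "i < P n \<Longrightarrow> real i / P n \<in> {0..<1}"
  using left_end_cyl cyl_subset by blast

lemma idx_left_end [simp]: "idx n (real i / P n) = i"
  by (subst idx_eq_iff) (auto simp: left_end_cyl)

lemma idx_div:
  assumes "0 \<le> x" "P N = P n * R"
  shows "idx n x = idx N x div R"
proof -
  have R: "R \<noteq> 0" using assms(2) P_nonzero[of N] by (metis mult_0_right)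
  have "\<lfloor>x * P N / real R\<rfloor> = \<lfloor>x * P N\<rfloor> div int R"
    using floor_divide_real_eq_div[of "int R" "x * P N"] by simp
  moreover have "x * P N / real R = x * P n" using assms R by simp
  ultimately show ?thesis unfolding idx_def using assms by (simp add: nat_div_distrib)
qed

lemma idx_coarse:
  assumes "0 \<le> x" "0 \<le> y" "n \<le> N" "idx N x = idx N y"
  shows "idx n x = idx n y"
proof -
  obtain R where "P N = P n * R" using P_factor[of n "N - n"] assms(3) by auto
  then show ?thesis using idx_div assms by metis
qed

text \<open>The type of values is left open so that predicates qualify too, which makes exceptional
  sets measurable in \<open>measure_vstep_set\<close>. Nothing is asked at the point 1, a null
  set.\<close>

definition vstep :: "nat \<Rightarrow> (real \<Rightarrow> 'a) \<Rightarrow> bool" where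
  "vstep n g \<longleftrightarrow> (\<forall>x\<in>{0..<1}. \<forall>y\<in>{0..<1}. idx n x = idx n y \<longrightarrow> g x = g y)"

lemma vstepI: "(\<And>x y. x \<in> {0..<1} \<Longrightarrow> y \<in> {0..<1} \<Longrightarrow> idx n x = idx n y \<Longrightarrow> g x = g y) \<Longrightarrow> vstep n g"
  unfolding vstep_def by blast

lemma vstepD: "vstep n g \<Longrightarrow> x \<in> {0..<1} \<Longrightarrow> y \<in> {0..<1} \<Longrightarrow> idx n x = idx n y \<Longrightarrow> g x = g y"
  unfolding vstep_def by blast

lemma vstep_mono: "vstep n g \<Longrightarrow> n \<le> N \<Longrightarrow> vstep N g"
  unfolding vstep_def using idx_coarse[of _ _ n N] by (meson atLeastLessThan_iff)

lemma vstep_idx: "k \<le> n \<Longrightarrow> vstep n (\<lambda>x. h (idx k x))"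
  by (rule vstepI) (metis atLeastLessThan_iff idx_coarse)

lemma vstep_comp: "vstep n g \<Longrightarrow> vstep n (\<lambda>x. h (g x))"
  unfolding vstep_def by metis

lemma vstep_comp2: "vstep n g \<Longrightarrow> vstep n g' \<Longrightarrow> vstep n (\<lambda>x. h (g x) (g' x))"
  unfolding vstep_def by metis

lemma vstep_sum: "(\<And>i. i \<in> I \<Longrightarrow> vstep n (g i)) \<Longrightarrow> vstep n (\<lambda>x. \<Sum>i\<in>I. g i x)"
  unfolding vstep_def by (intro ballI impI sum.cong refl) blast

lemma vstep_left_end: "vstep n g \<Longrightarrow> x \<in> {0..<1} \<Longrightarrow> g x = g (real (idx n x) / P n)"
  by (erule vstepD) (simp_all add: left_end_mem idx_less)

lemma measure_space_M: "measure M {0..1} = 1"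
  by (simp add: measure_restrict_space)

lemma finite_M: "finite_measure M"
  by (rule finite_measureI) (simp add: emeasure_restrict_space)

lemma cyl_sets: "i < P n \<Longrightarrow> cyl n i \<in> sets M"
proof -
  assume "i < P n"
  then have "cyl n i \<subseteq> {0..1}" using cyl_subset[of i n] by auto
  then show ?thesis by (subst sets_restrict_space_iff) (simp_all add: cyl_def)
qed

lemma measure_cyl: "i < P n \<Longrightarrow> measure M (cyl n i) = 1 / P n"
proof -
  assume i: "i < P n"
  then have "measure M (cyl n i) = measure lebesgue (cyl n i)"
    using cyl_subset[of i n] by (intro measure_restrict_space) auto
  also have "\<dots> = (real i + 1) / P n - real i / P n"
    unfolding cyl_def by (simp add: divide_right_mono measure_completion)
  also have "\<dots> = 1 / P n" by (simp add: diff_divide_distrib[symmetric])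
  finally show ?thesis .
qed

lemma AE_M_unit: "AE x in M. x \<in> {0..<1}"
proof (rule AE_I')
  show "{1::real} \<in> null_sets M"
    by (subst null_sets_restrict_space) auto
qed auto

lemma has_integral_indicator_scaleR:
  fixes c :: "'a :: {banach, second_countable_topology}"
  assumes "A \<in> sets M"
  shows "has_bochner_integral M (\<lambda>x. indicator A x *\<^sub>R c) (measure M A *\<^sub>R c)"
proof -
  interpret finite_measure M by (rule finite_M)
  show ?thesis
    by (intro has_bochner_integral_scaleR_left has_bochner_integral_real_indicator assms)
      (simp add: top.not_eq_extremum[symmetric])
qed

lemma has_integral_vstep:
  fixes g :: "real \<Rightarrow> 'a :: {banach, second_countable_topology}"
  assumes "vstep n g"
  shows "has_bochner_integral M g (\<Sum>i<P n. (1 / P n) *\<^sub>R g (real i / P n))"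
proof -
  \<comment> \<open>The cylinders only cover [0,1), so the point 1 needs a term of its own; it has
    measure zero.\<close>
  let ?h = "\<lambda>x. (\<Sum>i<P n. indicator (cyl n i) x *\<^sub>R g (real i / P n)) + indicator {1} x *\<^sub>R g 1"
  have eq: "g x = ?h x" if "x \<in> space M" for x
  proof (cases "x = 1")
    case True
    then have "x \<notin> cyl n i" if "i < P n" for i using cyl_subset[OF that] by auto
    then show ?thesis using True by simp
  next
    case False
    then have x: "x \<in> {0..<1}" using that by auto
    have mem: "x \<in> cyl n i \<longleftrightarrow> i = idx n x" for i using idx_eq_iff[of x n i] x by auto
    have "(\<Sum>i<P n. indicator (cyl n i) x *\<^sub>R g (real i / P n))
        = (\<Sum>i<P n. if i = idx n x then g (real i / P n) else 0)"
      by (intro sum.cong refl) (simp add: indicator_def mem)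
    also have "\<dots> = g x" using idx_less[OF x] vstep_left_end[OF assms x] by simp
    finally show ?thesis using False by simp
  qed
  have "{1} \<in> sets M" by (simp add: sets_restrict_space_iff)
  then have "has_bochner_integral M ?h ((\<Sum>i<P n. measure M (cyl n i) *\<^sub>R g (real i / P n)) + measure M {1} *\<^sub>R g 1)"
    by (intro has_bochner_integral_add has_bochner_integral_sum has_integral_indicator_scaleR cyl_sets) simp_all
  moreover have "measure M {1} = 0" by (simp add: measure_restrict_space)
  moreover have "(\<Sum>i<P n. measure M (cyl n i) *\<^sub>R g (real i / P n)) = (\<Sum>i<P n. (1 / P n) *\<^sub>R g (real i / P n))"
    by (intro sum.cong refl) (simp add: measure_cyl)
  ultimately have "has_bochner_integral M ?h (\<Sum>i<P n. (1 / P n) *\<^sub>R g (real i / P n))" by simp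
  moreover have "has_bochner_integral M g y \<longleftrightarrow> has_bochner_integral M ?h y" for y
    by (intro has_bochner_integral_cong eq refl)
  ultimately show ?thesis by blast
qed

lemma integrable_vstep:
  fixes g :: "real \<Rightarrow> 'a :: {banach, second_countable_topology}"
  assumes "vstep n g"
  shows "integrable M g"
  using has_integral_vstep[OF assms] by (auto simp: has_bochner_integral_iff)

subsection \<open>Characters and Dirichlet kernels\<close>

lemma norm_w [simp]: "norm (w n x) = 1"
  unfolding vilenkin_def by (simp add: norm_exp_eq_Re)

lemma w_mult_cnj [simp]: "w n x * cnj (w n x) = 1"
  by (simp add: complex_norm_square[symmetric])

text \<open>The factor that digit \<open>Suc k\<close> contributes to \<open>w a x\<close>, written
  with the closed formulas for the digits.\<close>

definition chi :: "nat \<Rightarrow> nat \<Rightarrow> real \<Rightarrow> complex" where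
  "chi k a x = exp (2 * of_real pi * \<i> * of_real
     (real (a div P k mod p (Suc k)) * real (idx (Suc k) x mod p (Suc k)) / real (p (Suc k))))"

text \<open>A number below \<open>P N\<close> has no nonzero digit beyond position \<open>N\<close>,
  so the series in the exponent is a finite sum.\<close>

lemma w_prod:
  assumes "a < P N" "x \<in> {0..<1}"
  shows "w a x = (\<Prod>k<N. chi k a x)"
proof -
  let ?t = "\<lambda>k. real (nat_digits p a (Suc k)) * real (frac_digits p x (Suc k)) / real (p (Suc k))"
  have t: "?t k = real (a div P k mod p (Suc k)) * real (idx (Suc k) x mod p (Suc k)) / real (p (Suc k))" for k
    using assms(2) by (simp add: nat_digits_formula[OF p_ge_2] frac_digits_formula[OF p_ge_2] idx_def)
  have "?t k = 0" if "k \<notin> {..<N}" for k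
  proof -
    have "a < P k" using assms(1) P_mono[of N k] that by simp
    then show ?thesis unfolding t by simp
  qed
  then have "(\<Sum>k. ?t k) = (\<Sum>k<N. ?t k)" by (intro suminf_finite) auto
  then show ?thesis
    unfolding vilenkin_def chi_def by (simp add: t exp_sum sum_distrib_left)
qed

lemma vstep_w:
  assumes "a < P N"
  shows "vstep N (w a)"
proof (rule vstepI)
  fix x y :: real assume *: "x \<in> {0..<1}" "y \<in> {0..<1}" "idx N x = idx N y"
  have "idx (Suc k) x = idx (Suc k) y" if "k < N" for k using * that idx_coarse[of x y "Suc k" N] by auto
  then show "w a x = w a y" using * assms by (simp add: w_prod chi_def)
qed

lemma less_P: "n < P n"
  by (rule vprod_gt[OF p_ge_2])

text \<open>The nonzero digits of \<open>a\<close> sit at positions up to \<open>k\<close>, those of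
  \<open>b * P k\<close> at later ones. The addition has no carries, and the exponents add digit by
  digit.\<close>

lemma w_add_mult:
  assumes a: "a < P k" and x: "x \<in> {0..<1}"
  shows "w (a + b * P k) x = w a x * w (b * P k) x"
proof -
  define N where "N = a + b * P k"
  have N: "a < P N" "b * P k < P N" "a + b * P k < P N" using less_P[of N] by (auto simp: N_def)
  have "chi j (a + b * P k) x = chi j a x * chi j (b * P k) x" for j
  proof -
    have "(a + b * P k) div P j mod p (Suc j) = a div P j mod p (Suc j) + b * P k div P j mod p (Suc j)"
    proof (cases "j < k")
      case True
      then obtain c where c: "P k = P j * p (Suc j) * c" using P_dvd[of "Suc j" k] by (auto simp: vprod_Suc)
      have e: "b * P k = P j * (p (Suc j) * (c * b))" by (simp add: c)
      show ?thesis unfolding e by simp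
    next
      case False
      then obtain c where c: "P j = P k * c" using P_dvd[of k j] by auto
      have aj: "a div P j = 0" using a P_mono[of k j] False by simp
      have "(a + b * P k) div P k = b" using a by simp
      then have "(a + b * P k) div P j = b div c" unfolding c by (simp only: div_mult2_eq)
      moreover have "b * P k div P j = b div c" unfolding c by (simp add: div_mult2_eq)
      ultimately show ?thesis using aj by simp
    qed
    then show ?thesis unfolding chi_def by (simp add: exp_add[symmetric] ring_distribs add_divide_distrib)
  qed
  then show ?thesis by (simp add: w_prod[OF N(1) x] w_prod[OF N(2) x] w_prod[OF N(3) x] prod.distrib)
qed

text \<open>The Dirichlet kernel as a function of two points rather than of their digitwise
  difference.\<close>

definition D :: "nat \<Rightarrow> real \<Rightarrow> real \<Rightarrow> complex" where
  "D m x y = (\<Sum>n<m. w n x * cnj (w n y))"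

lemma vstep_D: "vstep N (D (P N) x)"
proof (rule vstepI)
  fix y z :: real assume "y \<in> {0..<1}" "z \<in> {0..<1}" "idx N y = idx N z"
  then have "w n y = w n z" if "n < P N" for n using vstepD[OF vstep_w[OF that]] by blast
  then show "D (P N) x y = D (P N) x z" by (simp add: D_def)
qed

text \<open>By \<open>w_add_mult\<close> all terms of the \<open>b\<close>-th block of length
  \<open>P k\<close> share the factor belonging to \<open>b * P k\<close>; what remains is a kernel
  of low order.\<close>

lemma D_blocks:
  assumes "x \<in> {0..<1}" "y \<in> {0..<1}" "r \<le> P k"
  shows "D (a * P k + r) x y = (\<Sum>b<a. w (b * P k) x * cnj (w (b * P k) y)) * D (P k) x y
     + w (a * P k) x * cnj (w (a * P k) y) * D r x y"
proof -
  have *: "w (n + b * P k) x * cnj (w (n + b * P k) y)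
      = w (b * P k) x * cnj (w (b * P k) y) * (w n x * cnj (w n y))" if "n < P k" for n b
    using that assms by (simp add: w_add_mult)
  have "(\<Sum>n<P k. w (n + b * P k) x * cnj (w (n + b * P k) y))
      = w (b * P k) x * cnj (w (b * P k) y) * D (P k) x y" for b
    unfolding D_def sum_distrib_left by (intro sum.cong refl *) simp
  moreover have "(\<Sum>n<r. w (n + a * P k) x * cnj (w (n + a * P k) y))
      = w (a * P k) x * cnj (w (a * P k) y) * D r x y"
    unfolding D_def sum_distrib_left by (intro sum.cong refl *) (use assms(3) in simp)
  ultimately show ?thesis
    unfolding D_def[of "a * P k + r"] sum_lessThan_add sum_lessThan_blocks by (simp add: sum_distrib_right)
qed

text \<open>Passing to the next rank multiplies the kernel by a sum over the
  \<open>p (Suc N)\<close> characters of digit \<open>Suc N\<close> alone. By orthogonality of roots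
  of unity this sum detects equality of that digit.\<close>

lemma D_full:
  assumes x: "x \<in> {0..<1}" and y: "y \<in> {0..<1}"
  shows "D (P N) x y = (if idx N x = idx N y then of_nat (P N) else 0)"
proof (induction N)
  case 0
  have "w 0 z = 1" if "z \<in> {0..<1}" for z using w_prod[of 0 0 z] that by simp
  moreover have "idx 0 x = idx 0 y" using idx_less[OF x, of 0] idx_less[OF y, of 0] by simp
  ultimately show ?case using x y by (simp add: D_def)
next
  case (Suc N)
  let ?q = "p (Suc N)"
  have q: "0 < ?q" using p_ge_2[of "Suc N"] by simp
  have wb: "w (b * P N) z = exp (2 * of_real pi * \<i> * of_real (real b * real (idx (Suc N) z mod ?q) / real ?q))"
    if "b < ?q" "z \<in> {0..<1}" for b z
  proof -
    \<comment> \<open>The digits of \<open>b * P N\<close> at positions up to \<open>N\<close>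
      vanish, so only the last factor of the product survives.\<close>
    have "chi k (b * P N) z = 1" if k: "k < N" for k
    proof -
      obtain c where c: "P N = P k * p (Suc k) * c" using P_dvd[of "Suc k" N] k by (auto simp: vprod_Suc)
      have e: "b * P N = P k * (p (Suc k) * (c * b))" by (simp add: c)
      show ?thesis unfolding chi_def e by simp
    qed
    moreover have "b * P N < P (Suc N)" using that by (simp add: vprod_Suc)
    ultimately show ?thesis using that by (simp add: w_prod[of _ "Suc N"] chi_def)
  qed
  have "D (P (Suc N)) x y = D (?q * P N + 0) x y" by (simp add: vprod_Suc mult.commute)
  also have "\<dots> = (\<Sum>b<?q. w (b * P N) x * cnj (w (b * P N) y)) * D (P N) x y"
    by (subst D_blocks[OF x y]) (simp_all add: D_def)
  also have "(\<Sum>b<?q. w (b * P N) x * cnj (w (b * P N) y))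
      = (if idx (Suc N) x mod ?q = idx (Suc N) y mod ?q then of_nat ?q else 0)"
    using roots_of_unity_orthogonal[of "idx (Suc N) x mod ?q" ?q "idx (Suc N) y mod ?q"] q x y
    by (simp add: wb)
  also have "\<dots> * D (P N) x y = (if idx (Suc N) x = idx (Suc N) y then of_nat (P (Suc N)) else 0)"
  proof -
    have "idx N x = idx (Suc N) x div ?q" "idx N y = idx (Suc N) y div ?q"
      using x y by (auto intro!: idx_div simp: vprod_Suc)
    then have "idx (Suc N) x = idx (Suc N) y \<longleftrightarrow> idx N x = idx N y \<and> idx (Suc N) x mod ?q = idx (Suc N) y mod ?q"
      by (metis div_mult_mod_eq)
    then show ?thesis using Suc by (auto simp: vprod_Suc)
  qed
  finally show ?case .
qed

text \<open>By \<open>D_full\<close> all complete blocks of length \<open>P k\<close> cancel when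
  the points lie in different cylinders of rank \<open>k\<close>; fewer than \<open>P k\<close>
  terms of modulus 1 are left.\<close>

lemma norm_D_le:
  assumes x: "x \<in> {0..<1}" and y: "y \<in> {0..<1}" and ne: "idx k x \<noteq> idx k y"
  shows "norm (D m x y) \<le> P k"
proof -
  define r where "r = m mod P k"
  have r: "r < P k" by (simp add: r_def)
  have "D m x y = D (m div P k * P k + r) x y" unfolding r_def by (simp only: div_mult_mod_eq)
  also have "\<dots> = w (m div P k * P k) x * cnj (w (m div P k * P k) y) * D r x y"
    using r ne by (subst D_blocks[OF x y]) (auto simp: D_full[OF x y])
  finally have "norm (D m x y) = norm (D r x y)" by (simp add: norm_mult)
  also have "\<dots> \<le> (\<Sum>n<r. norm (w n x * cnj (w n y)))" unfolding D_def by (rule norm_sum)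
  also have "\<dots> = r" by (simp add: norm_mult)
  finally show ?thesis using r by simp
qed

section \<open>Fourier coefficients and partial sums of integrable functions\<close>

lemma integrable_mult_cnj_w:
  assumes "integrable M g"
  shows "integrable M (\<lambda>x. g x * cnj (w n x))"
proof (rule Bochner_Integration.integrable_bound[OF assms])
  show "(\<lambda>x. g x * cnj (w n x)) \<in> borel_measurable M"
    by (rule borel_measurable_times[OF borel_measurable_integrable[OF assms]
      borel_measurable_integrable[OF integrable_vstep[OF vstep_comp[OF vstep_w[OF less_P]]]]])
qed (simp add: norm_mult)

lemma coeff_add: "integrable M g \<Longrightarrow> integrable M h \<Longrightarrow> coeff (\<lambda>x. g x + h x) n = coeff g n + coeff h n"
  unfolding vilenkin_coeff_def by (simp add: ring_distribs integrable_mult_cnj_w)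

lemma coeff_diff: "integrable M g \<Longrightarrow> integrable M h \<Longrightarrow> coeff (\<lambda>x. g x - h x) n = coeff g n - coeff h n"
  unfolding vilenkin_coeff_def by (simp add: ring_distribs integrable_mult_cnj_w)

lemma norm_coeff_le:
  assumes "integrable M g"
  shows "norm (coeff g n) \<le> (LINT x|M. norm (g x))"
proof -
  have "norm (coeff g n) \<le> (LINT x|M. norm (g x * cnj (w n x)))"
    unfolding vilenkin_coeff_def by (rule integral_norm_bound)
  then show ?thesis by (simp add: norm_mult)
qed

lemma S_add: "integrable M g \<Longrightarrow> integrable M h \<Longrightarrow> S (\<lambda>x. g x + h x) m x = S g m x + S h m x"
  unfolding vilenkin_partial_sum_def by (simp add: coeff_add ring_distribs sum.distrib)

lemma S_eq_kernel:
  assumes "integrable M g"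
  shows "S g m x = (LINT y|M. g y * D m x y)"
proof -
  have "S g m x = (\<Sum>n<m. LINT y|M. g y * cnj (w n y) * w n x)"
    unfolding vilenkin_partial_sum_def vilenkin_coeff_def by simp
  also have "\<dots> = (LINT y|M. (\<Sum>n<m. g y * cnj (w n y) * w n x))"
    by (rule Bochner_Integration.integral_sum[symmetric])
      (use integrable_mult_cnj_w[OF assms] in simp)
  also have "\<dots> = (LINT y|M. g y * D m x y)"
    by (simp add: D_def sum_distrib_left mult_ac)
  finally show ?thesis .
qed

lemma integral_cong_unit:
  fixes g h :: "real \<Rightarrow> 'a :: {banach, second_countable_topology}"
  assumes "\<And>x. x \<in> {0..<1} \<Longrightarrow> g x = h x" "integrable M g" "integrable M h"
  shows "(LINT x|M. g x) = (LINT x|M. h x)"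
  using assms AE_M_unit by (intro integral_cong_AE) auto

lemma integral_mono_unit:
  fixes g h :: "real \<Rightarrow> real"
  assumes "\<And>x. x \<in> {0..<1} \<Longrightarrow> g x \<le> h x" "integrable M g" "integrable M h"
  shows "(LINT x|M. g x) \<le> (LINT x|M. h x)"
  using assms AE_M_unit by (intro integral_mono_AE) auto

text \<open>By \<open>D_full\<close> the kernel of order \<open>P N\<close> averages over cylinders
  of rank \<open>N\<close>, and such an average leaves \<open>g\<close> unchanged.\<close>

lemma S_P_vstep:
  assumes g: "vstep N g" and x: "x \<in> {0..<1}"
  shows "S g (P N) x = g x"
proof -
  have step: "vstep N (\<lambda>y. g y * D (P N) x y)"
    by (rule vstep_comp2[OF g vstep_D])
  have "S g (P N) x = (\<Sum>i<P N. (1 / P N) *\<^sub>R (g (real i / P N) * D (P N) x (real i / P N)))"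
    unfolding S_eq_kernel[OF integrable_vstep[OF g]] using has_integral_vstep[OF step]
    by (rule has_bochner_integral_integral_eq)
  also have "\<dots> = (\<Sum>i<P N. if i = idx N x then g (real i / P N) else 0)"
    by (intro sum.cong refl) (use x in \<open>simp add: D_full left_end_mem scaleR_conv_of_real\<close>)
  also have "\<dots> = g x" using idx_less[OF x] vstep_left_end[OF g x] by simp
  finally show ?thesis .
qed

lemma integrable_w: "integrable M (w k)"
  by (rule integrable_vstep[OF vstep_w[OF less_P]])

lemma coeff_poly: "coeff (\<lambda>x. \<Sum>a<K. c a * w a x) n = (\<Sum>a<K. c a * coeff (w a) n)"
proof -
  have "coeff (\<lambda>x. \<Sum>a<K. c a * w a x) n = (LINT x|M. (\<Sum>a<K. c a * (w a x * cnj (w n x))))"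
    unfolding vilenkin_coeff_def by (simp add: sum_distrib_right mult.assoc)
  also have "\<dots> = (\<Sum>a<K. LINT x|M. c a * (w a x * cnj (w n x)))"
    by (rule Bochner_Integration.integral_sum) (simp add: integrable_mult_cnj_w integrable_w)
  finally show ?thesis by (simp add: vilenkin_coeff_def)
qed

lemma coeff_cong_unit:
  assumes "\<And>x. x \<in> {0..<1} \<Longrightarrow> g x = h x" "integrable M g" "integrable M h"
  shows "coeff g n = coeff h n"
  unfolding vilenkin_coeff_def using assms by (intro integral_cong_unit integrable_mult_cnj_w) auto

text \<open>Take coefficients in the finite expansion of \<open>g\<close> given by
  \<open>S_P_vstep\<close>. Orthogonality of the characters is derived from this identity in
  \<open>coeff_w\<close>.\<close>

lemma coeff_vstep:
  assumes "vstep N g"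
  shows "coeff g n = (\<Sum>a<P N. coeff g a * coeff (w a) n)"
proof -
  have "coeff g n = coeff (\<lambda>x. \<Sum>a<P N. coeff g a * w a x) n"
  proof (rule coeff_cong_unit)
    show "g x = (\<Sum>a<P N. coeff g a * w a x)" if "x \<in> {0..<1}" for x
      using S_P_vstep[OF assms that] unfolding vilenkin_partial_sum_def by simp
  qed (auto simp: integrable_w integrable_vstep[OF assms])
  then show ?thesis by (simp only: coeff_poly)
qed

text \<open>Expanding \<open>w l\<close> by the previous lemma shows that the squares of its coefficients have
  sum 1, while the \<open>l\<close>-th one alone is already 1.\<close>

lemma coeff_w: "coeff (w l) n = (if n = l then 1 else 0)"
proof -
  define N where "N = max n l"
  have nl: "n < P N" "l < P N" using less_P[of N] by (auto simp: N_def)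
  define c where "c = coeff (w l)"
  have one: "coeff (w l) l = 1" unfolding vilenkin_coeff_def by (simp add: measure_restrict_space)
  have cnj_c: "coeff (w a) l = cnj (c a)" for a
  proof -
    have "cnj (c a) = (LINT x|M. cnj (w l x * cnj (w a x)))"
      unfolding c_def vilenkin_coeff_def by (simp only: Bochner_Integration.integral_cnj)
    then show ?thesis by (simp add: vilenkin_coeff_def mult.commute)
  qed
  have "1 = (\<Sum>a<P N. c a * coeff (w a) l)"
    using coeff_vstep[OF vstep_w[OF nl(2)], of l] unfolding one c_def .
  also have "\<dots> = (\<Sum>a<P N. c a * cnj (c a))" by (simp only: cnj_c)
  also have "\<dots> = of_real (\<Sum>a<P N. (norm (c a))\<^sup>2)" by (simp add: complex_norm_square[symmetric])
  finally have "(\<Sum>a<P N. (norm (c a))\<^sup>2) = 1" by (metis of_real_eq_1_iff)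
  then have sum0: "(\<Sum>a\<in>{..<P N} - {l}. (norm (c a))\<^sup>2) = 0"
    using nl one by (subst (asm) sum.remove[of _ l]) (simp_all add: c_def)
  have "c n = 0" if "n \<noteq> l"
    using sum0 nl(1) that by (subst (asm) sum_nonneg_eq_0_iff) auto
  then show ?thesis using one by (auto simp: c_def)
qed

lemma coeff_vstep_eq_0: "vstep N g \<Longrightarrow> P N \<le> n \<Longrightarrow> coeff g n = 0"
  by (subst coeff_vstep) (auto simp: coeff_w intro!: sum.neutral)

lemma S_vstep:
  assumes g: "vstep N g" and x: "x \<in> {0..<1}" and m: "P N \<le> m"
  shows "S g m x = g x"
proof -
  have "S g m x = S g (P N) x"
    unfolding vilenkin_partial_sum_def
    by (rule sum.mono_neutral_right) (use m coeff_vstep_eq_0[OF g] in auto)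
  then show ?thesis using S_P_vstep[OF g x] by simp
qed

subsection \<open>Partial sums off the support\<close>

text \<open>All points of the support lie in one cylinder of rank \<open>k\<close>, which
  \<open>x\<close> avoids, so \<open>norm_D_le\<close> bounds the kernel by \<open>P k\<close>
  there.\<close>

lemma norm_S_off_cyl:
  assumes i: "i < P n" and g: "integrable M g"
    and supp: "\<And>x. x \<in> {0..<1} \<Longrightarrow> idx n x \<noteq> i \<Longrightarrow> g x = 0"
    and x: "x \<in> {0..<1}" and k: "k \<le> n" "idx k x \<noteq> idx k (real i / P n)"
  shows "norm (S g m x) \<le> P k * (LINT y|M. norm (g y))"
proof -
  have "(\<lambda>y. g y * D m x y) = (\<lambda>y. \<Sum>a<m. g y * cnj (w a y) * w a x)"
    by (rule ext) (simp add: D_def sum_distrib_left mult_ac)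
  then have int: "integrable M (\<lambda>y. g y * D m x y)"
    using integrable_mult_cnj_w[OF g] by simp
  have "norm (S g m x) \<le> (LINT y|M. norm (g y * D m x y))"
    unfolding S_eq_kernel[OF g] by (rule integral_norm_bound)
  also have "\<dots> \<le> (LINT y|M. P k * norm (g y))"
  proof (rule integral_mono_unit)
    fix y :: real assume y: "y \<in> {0..<1}"
    show "norm (g y * D m x y) \<le> P k * norm (g y)"
    proof (cases "idx n y = i")
      case True
      have "idx k y = idx k (real i / P n)"
        by (rule idx_coarse[OF _ _ k(1)]) (use True y in auto)
      then have "norm (D m x y) \<le> P k" using norm_D_le[OF x y] k(2) by simp
      then have "norm (g y) * norm (D m x y) \<le> norm (g y) * P k" by (intro mult_left_mono) auto
      then show ?thesis by (simp add: norm_mult mult.commute)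
    qed (use supp[OF y] in simp)
  qed (use int g in auto)
  finally show ?thesis by simp
qed

lemma B_ge_2: "2 \<le> B"
  using p_ge_2[of 1] p_le_B[of 1] by simp

text \<open>Let \<open>G\<close> be the norm of \<open>g\<close> and \<open>k\<close> the least rank
  with \<open>l < P k * G\<close>. The cylinder of rank \<open>k - 1\<close> around the support
  serves as \<open>F\<close>: off it the sums are at most \<open>P (k - 1) * G \<le> l\<close>, and
  since one rank costs at most a factor \<open>B\<close>, its measure is at most
  \<open>B * G / l\<close>.\<close>

lemma weak_type_off_cyl:
  assumes i: "i < P n" and g: "integrable M g" and l: "0 < l"
    and supp: "\<And>x. x \<in> {0..<1} \<Longrightarrow> idx n x \<noteq> i \<Longrightarrow> g x = 0"
  obtains F where "F \<in> sets M" "measure M F \<le> B * (LINT y|M. norm (g y)) / l"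
    "\<And>x m. x \<in> {0..<1} \<Longrightarrow> x \<notin> F \<Longrightarrow> idx n x \<noteq> i \<Longrightarrow> norm (S g m x) \<le> l"
proof -
  define G where "G = (LINT y|M. norm (g y))"
  have G0: "0 \<le> G" unfolding G_def by simp
  note off = norm_S_off_cyl[OF i g supp, folded G_def]
  show thesis
  \<comment> \<open>If \<open>P n * G \<le> l\<close>, avoiding the supporting cylinder suffices and
    \<open>F\<close> is empty.\<close>
  proof (cases "P n * G \<le> l")
    case True
    show thesis
    proof (rule that[of "{}"])
      fix x m assume "x \<in> {0..<1}" "idx n x \<noteq> i"
      then have "norm (S g m x) \<le> P n * G" by (intro off) auto
      then show "norm (S g m x) \<le> l" using True by simp
    qed (use G0 l in \<open>auto simp: G_def[symmetric]\<close>)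
  next
    case False
    define k where "k = (LEAST k. l < P k * G)"
    have "l < P n * G" using False by simp
    then have k: "l < P k * G" "k \<le> n" unfolding k_def by (rule LeastI, rule Least_le)
    show thesis
    proof (cases k)
      \<comment> \<open>Here \<open>l < G\<close>, so the bound required of \<open>F\<close> is at
        least 1 and the whole interval may be taken.\<close>
      case 0
      have "1 * l \<le> B * G" using k 0 B_ge_2 l G0 by (intro mult_mono) auto
      then have "1 \<le> B * G / l" using l by (simp add: field_simps)
      then show thesis using measure_space_M
        by (intro that[of "{0..1}"]) (auto simp: G_def[symmetric] sets_restrict_space_iff)
    next
      case (Suc j)
      let ?a = "idx j (real i / P n)"
      have a: "?a < P j" by (intro idx_less left_end_mem i)
      have small: "P j * G \<le> l" using not_less_Least[of j "\<lambda>k. l < P k * G"] Suc by (simp add: k_def)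
      have "P k \<le> P j * B" unfolding Suc vprod_Suc using p_le_B[of "Suc j"] by simp
      then have "P k * G \<le> real (P j * B) * G" using G0 by (intro mult_right_mono of_nat_mono)
      then have "1 / P j \<le> B * G / l" using k(1) l by (simp add: field_simps)
      then show thesis
      proof (intro that[of "cyl j ?a"])
        fix x m assume x: "x \<in> {0..<1}" "x \<notin> cyl j ?a"
        then have "idx j x \<noteq> ?a" using idx_eq_iff[of x j ?a] by auto
        then have "norm (S g m x) \<le> P j * G" using x k(2) Suc by (intro off) auto
        then show "norm (S g m x) \<le> l" using small by simp
      qed (auto simp: cyl_sets measure_cyl a G_def[symmetric])
    qed
  qed
qed

subsection \<open>Removal of low frequencies\<close>

text \<open>For \<open>y\<close> with \<open>selects n N y\<close> this is a density of mean 1 over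
  each cylinder of rank \<open>n\<close>, concentrated on one subcylinder of rank \<open>N\<close>.
  Multiplication by it moves the mass of a cylinder onto that subcylinder.\<close>

definition tau :: "nat \<Rightarrow> nat \<Rightarrow> (nat \<Rightarrow> nat) \<Rightarrow> real \<Rightarrow> real" where
  "tau n N y x = (if idx N x = y (idx n x) then P N / P n else 0)"

definition selects :: "nat \<Rightarrow> nat \<Rightarrow> (nat \<Rightarrow> nat) \<Rightarrow> bool" where
  "selects n N y \<longleftrightarrow> n \<le> N \<and> (\<forall>l<P n. y l < P N \<and> cyl N (y l) \<subseteq> cyl n l)"

lemma vstep_tau: "n \<le> N \<Longrightarrow> vstep N (tau n N y)"
  unfolding tau_def by (rule vstepI) (metis atLeastLessThan_iff idx_coarse)

lemma integral_tau:
  fixes g :: "real \<Rightarrow> 'a :: {banach, second_countable_topology}"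
  assumes y: "selects n N y" and g: "vstep n g"
  shows "(LINT x|M. tau n N y x *\<^sub>R g x) = (LINT x|M. g x)"
proof -
  have nN: "n \<le> N" using y by (simp add: selects_def)
  have yl: "y l < P N" "cyl N (y l) \<subseteq> cyl n l" if "l < P n" for l using y that by (auto simp: selects_def)
  let ?h = "\<lambda>x. \<Sum>l<P n. indicator (cyl N (y l)) x *\<^sub>R ((P N / P n) *\<^sub>R g (real l / P n))"
  have h: "has_bochner_integral M ?h (\<Sum>l<P n. measure M (cyl N (y l)) *\<^sub>R ((P N / P n) *\<^sub>R g (real l / P n)))"
    by (intro has_bochner_integral_sum has_integral_indicator_scaleR cyl_sets yl) simp
  have "(LINT x|M. tau n N y x *\<^sub>R g x) = (LINT x|M. ?h x)"
  proof (rule integral_cong_unit)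
    fix x :: real assume x: "x \<in> {0..<1}"
    have mem: "x \<in> cyl N (y l) \<longleftrightarrow> l = idx n x \<and> idx N x = y (idx n x)" if "l < P n" for l
    proof
      assume a: "x \<in> cyl N (y l)"
      then have "idx n x = l" using yl[OF that] x idx_eq_iff[of x n l] by auto
      moreover have "idx N x = y l" using a x idx_eq_iff[of x N "y l"] by auto
      ultimately show "l = idx n x \<and> idx N x = y (idx n x)" by simp
    next
      assume "l = idx n x \<and> idx N x = y (idx n x)"
      then show "x \<in> cyl N (y l)" using x idx_eq_iff[of x N "y l"] by auto
    qed
    have "?h x = (\<Sum>l<P n. if l = idx n x then tau n N y x *\<^sub>R g (real l / P n) else 0)"
      by (intro sum.cong refl) (auto simp: mem tau_def indicator_def)
    also have "\<dots> = tau n N y x *\<^sub>R g x" using idx_less[OF x] vstep_left_end[OF g x] by simp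
    finally show "tau n N y x *\<^sub>R g x = ?h x" ..
  next
    show "integrable M (\<lambda>x. tau n N y x *\<^sub>R g x)"
      by (rule integrable_vstep[OF vstep_comp2[OF vstep_tau[OF nN] vstep_mono[OF g nN]]])
  qed (use h in \<open>auto simp: has_bochner_integral_iff\<close>)
  also have "\<dots> = (\<Sum>l<P n. measure M (cyl N (y l)) *\<^sub>R ((P N / P n) *\<^sub>R g (real l / P n)))"
    using h by (rule has_bochner_integral_integral_eq)
  also have "\<dots> = (\<Sum>l<P n. (1 / P n) *\<^sub>R g (real l / P n))"
    by (intro sum.cong refl) (simp add: measure_cyl yl)
  also have "\<dots> = (LINT x|M. g x)"
    using has_integral_vstep[OF g] by (simp add: has_bochner_integral_iff)
  finally show ?thesis .
qed

definition correct :: "nat \<Rightarrow> nat \<Rightarrow> (nat \<Rightarrow> nat) \<Rightarrow> (real \<Rightarrow> complex) \<Rightarrow> real \<Rightarrow> complex" where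
  "correct n N y g x = g x - tau n N y x *\<^sub>R g x"

text \<open>For \<open>a < P n\<close> the product of \<open>g\<close> with the conjugate character
  is still constant on cylinders of rank \<open>n\<close>; by \<open>integral_tau\<close> the factor
  \<open>tau\<close> does not change its integral, and the two terms cancel. The norm at most
  doubles because moving the mass preserves the norm.\<close>

lemma correct_props:
  assumes y: "selects n N y" and g: "vstep n g"
  shows "vstep N (correct n N y g)"
    and "a < P n \<Longrightarrow> coeff (correct n N y g) a = 0"
    and "coeff (correct n N y g) a = coeff g a - (LINT x|M. tau n N y x *\<^sub>R (g x * cnj (w a x)))"
    and "(LINT x|M. norm (correct n N y g x)) \<le> 2 * (LINT x|M. norm (g x))"
proof -
  have nN: "n \<le> N" using y by (simp add: selects_def)
  have gN: "vstep N g" and tN: "vstep N (tau n N y)" using g nN by (auto intro: vstep_mono vstep_tau)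
  have tg: "integrable M (\<lambda>x. tau n N y x *\<^sub>R g x)" by (rule integrable_vstep[OF vstep_comp2[OF tN gN]])
  show "vstep N (correct n N y g)" unfolding correct_def by (rule vstep_comp2[OF gN vstep_comp2[OF tN gN]])
  show *: "coeff (correct n N y g) a = coeff g a - (LINT x|M. tau n N y x *\<^sub>R (g x * cnj (w a x)))" for a
    unfolding correct_def using integrable_vstep[OF g] tg by (subst coeff_diff) (auto simp: vilenkin_coeff_def)
  show "coeff (correct n N y g) a = 0" if "a < P n"
  proof -
    have "vstep n (\<lambda>x. g x * cnj (w a x))" by (rule vstep_comp2[OF g vstep_comp[OF vstep_w[OF that]]])
    from integral_tau[OF y this] show ?thesis unfolding * by (simp add: vilenkin_coeff_def)
  qed
  have "(LINT x|M. norm (correct n N y g x)) \<le> (LINT x|M. norm (g x) + tau n N y x *\<^sub>R norm (g x))"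
  proof (rule integral_mono_unit)
    show "norm (correct n N y g x) \<le> norm (g x) + tau n N y x *\<^sub>R norm (g x)" for x
      unfolding correct_def using norm_triangle_ineq4[of "g x" "tau n N y x *\<^sub>R g x"] by (simp add: tau_def)
  qed (use integrable_vstep[OF g] tg in \<open>auto simp: correct_def intro!: integrable_vstep[OF vstep_comp2[OF tN vstep_comp[OF gN]], of "\<lambda>t z. t * z"]\<close>)
  also have "\<dots> = (LINT x|M. norm (g x)) + (LINT x|M. tau n N y x *\<^sub>R norm (g x))"
    using integrable_vstep[OF g]
    by (intro Bochner_Integration.integral_add integrable_norm integrable_vstep[OF vstep_comp2[OF tN vstep_comp[OF gN]]])
  also have "\<dots> = 2 * (LINT x|M. norm (g x))" using integral_tau[OF y vstep_comp[OF g, of norm]] by simp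
  finally show "(LINT x|M. norm (correct n N y g x)) \<le> 2 * (LINT x|M. norm (g x))" .
qed

text \<open>Pieces supported on different cylinders and corrected one after the other have spectra in
  consecutive blocks, so a partial sum of the total consists of some complete pieces,
  of which at most one is nonzero at \<open>x\<close>, and of a partial sum of a single piece.\<close>

lemma sequential_correction:
  fixes Q :: "nat \<Rightarrow> (real \<Rightarrow> complex) \<Rightarrow> bool"
  assumes step: "\<And>i n'. i < K \<Longrightarrow> n \<le> n' \<Longrightarrow>
      \<exists>N u. n' \<le> N \<and> vstep N u \<and> (\<forall>a<P n'. coeff u a = 0) \<and> Q i u"
    and supp: "\<And>i u x. i < K \<Longrightarrow> Q i u \<Longrightarrow> x \<in> {0..<1} \<Longrightarrow> idx n x \<noteq> i \<Longrightarrow> u x = 0"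
  shows "\<exists>u N. n \<le> N \<and> (\<forall>i<K. Q i (u i) \<and> vstep N (u i)) \<and>
     (\<forall>x\<in>{0..<1}. \<forall>e\<ge>0. (\<forall>i<K. \<forall>m. norm (S (u i) m x) \<le> e) \<longrightarrow>
        (\<forall>m. norm (S (\<lambda>x. \<Sum>i<K. u i x) m x) \<le> 2 * e))"
  using assms
proof (induction K)
  case 0
  have "S (\<lambda>x. 0) m x = 0" for m x by (simp add: vilenkin_partial_sum_def vilenkin_coeff_def)
  then show ?case by (intro exI[of _ "\<lambda>_ _. 0"] exI[of _ n]) auto
next
  case (Suc K)
  have "\<exists>u N. n \<le> N \<and> (\<forall>i<K. Q i (u i) \<and> vstep N (u i)) \<and>
     (\<forall>x\<in>{0..<1}. \<forall>e\<ge>0. (\<forall>i<K. \<forall>m. norm (S (u i) m x) \<le> e) \<longrightarrow>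
        (\<forall>m. norm (S (\<lambda>x. \<Sum>i<K. u i x) m x) \<le> 2 * e))"
  proof (rule Suc.IH)
    fix i n' assume "i < K" "n \<le> n'"
    then show "\<exists>N u. n' \<le> N \<and> vstep N u \<and> (\<forall>a<P n'. coeff u a = 0) \<and> Q i u"
      using Suc.prems(1)[of i n'] by simp
  next
    fix i u x assume "i < K" "Q i u" "x \<in> {0..<1::real}" "idx n x \<noteq> i"
    then show "u x = 0" using Suc.prems(2)[of i u x] by simp
  qed
  then obtain u N where N: "n \<le> N" and uN: "\<forall>i<K. Q i (u i) \<and> vstep N (u i)"
    and bd: "\<forall>x\<in>{0..<1}. \<forall>e\<ge>0. (\<forall>i<K. \<forall>m. norm (S (u i) m x) \<le> e) \<longrightarrow>
        (\<forall>m. norm (S (\<lambda>x. \<Sum>i<K. u i x) m x) \<le> 2 * e)" by (elim exE conjE) (rule that)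
  have u: "Q i (u i)" "vstep N (u i)" if "i < K" for i using uN that by auto
  \<comment> \<open>The new piece starts from the rank \<open>N\<close>, which resolves all earlier
    pieces: their frequencies lie below \<open>P N\<close>, its own from \<open>P N\<close>
    on.\<close>
  obtain N' v where v: "N \<le> N'" "vstep N' v" "\<And>a. a < P N \<Longrightarrow> coeff v a = 0" "Q K v"
    using Suc.prems(1)[of K N] N by auto
  define u' where "u' = u(K := v)"
  have sum_eq: "(\<lambda>x. \<Sum>i<Suc K. u' i x) = (\<lambda>x. (\<Sum>i<K. u i x) + v x)"
    by (rule ext) (simp add: u'_def)
  have U: "vstep N (\<lambda>x. \<Sum>i<K. u i x)" using u(2) by (intro vstep_sum) simp
  have bound: "norm (S (\<lambda>x. \<Sum>i<Suc K. u' i x) m x) \<le> 2 * e"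
    if x: "x \<in> {0..<1}" and e: "0 \<le> e" and le: "\<And>i m. i < Suc K \<Longrightarrow> norm (S (u' i) m x) \<le> e" for x e m
  proof -
    have le_u: "norm (S (u i) m x) \<le> e" if "i < K" for i m using le[of i m] that by (simp add: u'_def)
    have le_v: "norm (S v m x) \<le> e" for m using le[of K m] by (simp add: u'_def)
    have S_eq: "S (\<lambda>x. \<Sum>i<Suc K. u' i x) m x = S (\<lambda>x. \<Sum>i<K. u i x) m x + S v m x"
      unfolding sum_eq by (rule S_add[OF integrable_vstep[OF U] integrable_vstep[OF v(2)]])
    show ?thesis
    proof (cases "m \<le> P N")
      case True
      then have "S v m x = 0" unfolding vilenkin_partial_sum_def by (intro sum.neutral) (simp add: v(3))
      moreover have "norm (S (\<lambda>x. \<Sum>i<K. u i x) m x) \<le> 2 * e"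
        using bd[rule_format, OF x e] le_u by simp
      ultimately show ?thesis using S_eq by simp
    next
      case False
      have "(\<Sum>i<K. u i x) = (\<Sum>i<K. if i = idx n x then u i x else 0)"
      proof (intro sum.cong refl)
        fix i assume "i \<in> {..<K}"
        then show "u i x = (if i = idx n x then u i x else 0)"
          using Suc.prems(2)[of i "u i" x] u(1)[of i] x by auto
      qed
      also have "\<dots> = (if idx n x < K then u (idx n x) x else 0)" by simp
      \<comment> \<open>A complete piece is at \<open>x\<close> its own partial sum of order
        \<open>P N\<close>, so the bound on partial sums also bounds its value.\<close>
      also have "norm \<dots> \<le> e"
        using le_u[of "idx n x" "P N"] u(2)[of "idx n x"] x e by (auto simp: S_P_vstep)
      finally have "norm (S (\<lambda>x. \<Sum>i<K. u i x) m x) \<le> e" using False S_vstep[OF U x, of m] by simp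
      then show ?thesis unfolding S_eq using le_v[of m] norm_triangle_ineq[of "S (\<lambda>x. \<Sum>i<K. u i x) m x" "S v m x"] by linarith
    qed
  qed
  have "Q i (u' i) \<and> vstep N' (u' i)" if "i < Suc K" for i
    using that u[of i] v(2,4) vstep_mono[OF _ v(1), of "u i"] by (cases "i = K") (simp_all add: u'_def)
  moreover have "n \<le> N'" using N v(1) by simp
  ultimately show ?case
    by (intro exI[of _ u'] exI[of _ N'] conjI allI impI ballI bound) simp_all
qed

lemma norm_S_le_sum_coeff:
  assumes "vstep N g"
  shows "norm (S g m x) \<le> (\<Sum>a<P N. norm (coeff g a))"
proof -
  have "S g m x = (\<Sum>a<min m (P N). coeff g a * w a x)"
    unfolding vilenkin_partial_sum_def
    by (rule sum.mono_neutral_right) (use coeff_vstep_eq_0[OF assms] in auto)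
  also have "norm \<dots> \<le> (\<Sum>a<min m (P N). norm (coeff g a))"
    by (rule order_trans[OF norm_sum]) (simp add: norm_mult)
  also have "\<dots> \<le> (\<Sum>a<P N. norm (coeff g a))" by (rule sum_mono2) auto
  finally show ?thesis .
qed

text \<open>The two have no common position with a nonzero digit: the left endpoint has zero digits
  after position \<open>n\<close>, the frequency \<open>b * P n\<close> zero digits up to
  \<open>n\<close>.\<close>

lemma w_block_left_end:
  assumes "l < P n"
  shows "w (b * P n) (real l / P n) = 1"
proof -
  have "chi k (b * P n) (real l / P n) = 1" for k
  proof (cases "k < n")
    case True
    then obtain c where c: "P n = P k * p (Suc k) * c" using P_dvd[of "Suc k" n] by (auto simp: vprod_Suc)
    have e: "b * P n = P k * (p (Suc k) * (c * b))" by (simp add: c)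
    show ?thesis unfolding chi_def e by simp
  next
    case False
    then obtain c where c: "P k = P n * c" using P_dvd[of n k] by auto
    have "real l / P n * P (Suc k) = real (l * c * p (Suc k))" by (simp add: c vprod_Suc)
    then have "idx (Suc k) (real l / P n) = l * c * p (Suc k)" unfolding idx_def by (simp only: floor_of_nat nat_int)
    then show ?thesis by (simp add: chi_def)
  qed
  then show ?thesis using w_prod[OF less_P left_end_mem[OF assms]] by simp
qed

lemma measure_vstep_set:
  assumes "vstep N Q"
  shows "{x \<in> {0..<1}. Q x} \<in> sets M"
    and "measure M {x \<in> {0..<1}. Q x} = (LINT x|M. (if Q x then 1 else 0))"
proof -
  let ?A = "{x \<in> {0..<1::real}. Q x}"
  have "vstep N (indicator ?A :: real \<Rightarrow> real)"
  proof (rule vstepI)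
    fix x y :: real assume *: "x \<in> {0..<1}" "y \<in> {0..<1}" "idx N x = idx N y"
    then have "Q x = Q y" by (rule vstepD[OF assms])
    then show "indicator ?A x = (indicator ?A y :: real)" using * by (simp add: indicator_def)
  qed
  then have int: "integrable M (indicator ?A :: real \<Rightarrow> real)" by (rule integrable_vstep)
  then have "?A \<inter> space M \<in> sets M"
    using borel_measurable_integrable borel_measurable_indicator_iff by blast
  moreover have sp: "?A \<inter> space M = ?A" by auto
  ultimately show "?A \<in> sets M" by simp
  have "measure M ?A = (LINT x|M. indicator ?A x)" using sp by simp
  also have "\<dots> = (LINT x|M. (if Q x then 1 else 0))"
    using int integrable_vstep[OF vstep_comp[OF assms, of "\<lambda>b. if b then 1 else 0 :: real"]]
    by (intro integral_cong_unit) auto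
  finally show "measure M ?A = (LINT x|M. (if Q x then 1 else 0))" .
qed

subsection \<open>Correction of a step function\<close>

text \<open>Membership in the cylinder is tested instead of \<open>idx\<close>, which is 0 at
  negative reals as well. The piece thus vanishes at every real outside the cylinder, and
  \<open>piece_eq_0\<close> is an identity of functions.\<close>

definition piece :: "nat \<Rightarrow> nat \<Rightarrow> (real \<Rightarrow> complex) \<Rightarrow> real \<Rightarrow> complex" where
  "piece n i g x = (if x \<in> cyl n i then g x else 0)"

lemma piece_eq: "x \<in> {0..<1} \<Longrightarrow> piece n i g x = (if idx n x = i then g x else 0)"
  unfolding piece_def using idx_eq_iff[of x n i] by simp

lemma vstep_piece: "vstep n g \<Longrightarrow> vstep n (piece n i g)"
proof (rule vstepI)
  fix x y :: real assume "vstep n g" and *: "x \<in> {0..<1}" "y \<in> {0..<1}" "idx n x = idx n y"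
  then have "g x = g y" by (rule vstepD)
  then show "piece n i g x = piece n i g y" by (simp only: piece_eq *)
qed

lemma piece_eq_0: "vstep n g \<Longrightarrow> i < P n \<Longrightarrow> g (real i / P n) = 0 \<Longrightarrow> piece n i g = (\<lambda>x. 0)"
proof
  fix x assume g: "vstep n g" "i < P n" "g (real i / P n) = 0"
  show "piece n i g x = 0"
  proof (cases "x \<in> cyl n i")
    case True
    then have x: "x \<in> {0..<1}" using cyl_subset g(2) by blast
    have "idx n x = i" using idx_eq_iff[of x n i] True x by simp
    then show ?thesis using vstep_left_end[OF g(1) x] g(3) by (simp add: piece_def)
  qed (simp add: piece_def)
qed

lemma integral_vstep:
  fixes g :: "real \<Rightarrow> 'a :: {banach, second_countable_topology}"
  shows "vstep n g \<Longrightarrow> (LINT x|M. g x) = (\<Sum>i<P n. (1 / P n) *\<^sub>R g (real i / P n))"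
  by (rule has_bochner_integral_integral_eq[OF has_integral_vstep])

lemma integral_norm_piece:
  assumes "vstep n g" "i < P n"
  shows "(LINT x|M. norm (piece n i g x)) = norm (g (real i / P n)) / P n"
proof -
  have "(LINT x|M. norm (piece n i g x)) = (\<Sum>j<P n. (1 / P n) *\<^sub>R norm (piece n i g (real j / P n)))"
    by (rule integral_vstep[OF vstep_comp[OF vstep_piece[OF assms(1)]]])
  also have "\<dots> = (\<Sum>j<P n. if j = i then norm (g (real i / P n)) / P n else 0)"
    by (intro sum.cong refl) (auto simp: piece_eq left_end_mem)
  finally show ?thesis using assms(2) by simp
qed

lemma sum_integral_pieces:
  assumes "vstep n g"
  shows "(\<Sum>i<P n. LINT x|M. norm (piece n i g x)) = (LINT x|M. norm (g x))"
  using integral_vstep[OF vstep_comp[OF assms, of norm]] by (simp add: integral_norm_piece[OF assms])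

lemma integral_norm_sum_le:
  fixes u :: "nat \<Rightarrow> real \<Rightarrow> complex"
  assumes "\<And>i. i < K \<Longrightarrow> integrable M (u i)"
  shows "(LINT x|M. norm (\<Sum>i<K. u i x)) \<le> (\<Sum>i<K. LINT x|M. norm (u i x))"
proof -
  have "(LINT x|M. norm (\<Sum>i<K. u i x)) \<le> (LINT x|M. (\<Sum>i<K. norm (u i x)))"
    using assms by (intro integral_mono norm_sum integrable_norm Bochner_Integration.integrable_sum) auto
  also have "\<dots> = (\<Sum>i<K. LINT x|M. norm (u i x))"
    using assms by (intro Bochner_Integration.integral_sum) auto
  finally show ?thesis .
qed

lemma sum_pieces_eq:
  assumes "\<And>i. i < P n \<Longrightarrow> idx n x \<noteq> i \<Longrightarrow> u i x = 0" "x \<in> {0..<1}"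
  shows "(\<Sum>i<P n. u i x) = (u (idx n x) x :: complex)"
proof -
  have "(\<Sum>i<P n. u i x) = (\<Sum>i<P n. if i = idx n x then u i x else 0)"
    using assms(1) by (intro sum.cong refl) auto
  then show ?thesis using idx_less[OF assms(2)] by simp
qed

lemma correct_supp: "x \<in> {0..<1} \<Longrightarrow> idx k x \<noteq> i \<Longrightarrow> correct n N y (piece k i g) x = 0"
  by (simp add: correct_def piece_eq)

text \<open>Taking the leftmost subcylinder of rank \<open>n' + q\<close> in every cylinder of rank
  \<open>n'\<close> makes the correction periodic in frequency: up to sign it copies the
  coefficients of the piece into each later block of length \<open>P n'\<close>. There are at most
  \<open>B ^ q\<close> blocks and in each at most \<open>P n\<close> nonzero coefficients of size at
  most \<open>e / P n\<close>, whence the bound \<open>e * B ^ q\<close> for all \<open>x\<close>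
  and \<open>m\<close>.\<close>

lemma small_piece:
  assumes g: "vstep n g" and i: "i < P n" and e: "norm (g (real i / P n)) \<le> e" and n': "n \<le> n'"
  shows "\<exists>N u. n' \<le> N \<and> vstep N u \<and> (\<forall>a<P n'. coeff u a = 0) \<and>
    (\<forall>x\<in>{0..<1}. idx n x \<noteq> i \<longrightarrow> u x = 0) \<and>
    (LINT x|M. norm (u x)) \<le> 2 * (LINT x|M. norm (piece n i g x)) \<and>
    (\<forall>m x. norm (S u m x) \<le> e * real B ^ q) \<and>
    measure M {x \<in> {0..<1}. idx n x = i \<and> u x \<noteq> g x} \<le> (1 / 2) ^ q / P n"
proof -
  obtain R where R: "P (n' + q) = P n' * R" "2 ^ q \<le> R" "R \<le> B ^ q" by (rule P_factor)
  define N where "N = n' + q"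
  define y where "y l = l * R" for l
  have R0: "0 < R" using R(2) by (metis gr0I not_le zero_less_numeral zero_less_power)
  have PN: "P N = P n' * R" by (simp add: N_def R)
  have sel: "selects n' N y"
    unfolding selects_def
  proof (intro conjI allI impI subsetI)
    fix l x assume l: "l < P n'" and x: "x \<in> cyl N (y l)"
    have x0: "0 \<le> x" using x by (rule cyl_nonneg)
    then have "idx N x = l * R" using x idx_eq_iff[of x N "y l"] by (simp add: y_def)
    then have "idx n' x = l" using idx_div[OF x0 PN] R0 by simp
    then show "x \<in> cyl n' l" using idx_eq_iff[OF x0] by simp
  qed (use R0 in \<open>auto simp: N_def[symmetric] PN y_def\<close>, simp add: N_def)
  let ?f = "piece n i g"
  define u where "u = correct n' N y ?f"
  have f: "vstep n ?f" by (rule vstep_piece[OF g])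
  have f': "vstep n' ?f" by (rule vstep_mono[OF f n'])
  note cp = correct_props[OF sel f', folded u_def]
  have coeff_le: "norm (coeff u a) \<le> norm (coeff ?f (a mod P n'))" if a: "a < P N" for a
  proof (cases "a < P n'")
    case True
    then show ?thesis using cp(2) by simp
  next
    case False
    let ?a = "a mod P n'"
    have a': "?a < P n'" by simp
    have a_eq: "a = ?a + a div P n' * P n'" by (simp only: mod_div_mult_eq)
    have v: "vstep n' (\<lambda>x. ?f x * cnj (w ?a x))" by (rule vstep_comp2[OF f' vstep_comp[OF vstep_w[OF a']]])
    \<comment> \<open>On a selected subcylinder \<open>w a\<close> is constant and equals its value
      at the left endpoint of the surrounding cylinder of rank \<open>n'\<close>. There the block
      part is 1, so only \<open>a mod P n'\<close> matters.\<close>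
    have wa: "w a x = w ?a x" if x: "x \<in> {0..<1}" and idx: "idx N x = y (idx n' x)" for x
    proof -
      let ?z = "real (idx n' x) / P n'"
      have z: "?z \<in> {0..<1}" by (rule left_end_mem[OF idx_less[OF x]])
      have "?z * P N = real (idx n' x * R)" by (simp add: PN)
      then have "idx N ?z = idx n' x * R" unfolding idx_def[of N] by (simp only: floor_of_nat nat_int)
      then have "w a x = w a ?z" using idx by (intro vstepD[OF vstep_w[OF a] x z]) (simp add: y_def)
      also have "\<dots> = w ?a ?z" using w_add_mult[OF a' z] w_block_left_end[OF idx_less[OF x]] a_eq
        by (metis mult.right_neutral)
      also have "\<dots> = w ?a x" by (rule vstep_left_end[OF vstep_w[OF a'] x, symmetric])
      finally show ?thesis .
    qed
    have tw: "(LINT x|M. tau n' N y x *\<^sub>R (?f x * cnj (w a x))) = (LINT x|M. tau n' N y x *\<^sub>R (?f x * cnj (w ?a x)))"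
    proof (rule integral_cong_unit)
      fix x :: real assume x: "x \<in> {0..<1}"
      show "tau n' N y x *\<^sub>R (?f x * cnj (w a x)) = tau n' N y x *\<^sub>R (?f x * cnj (w ?a x))"
        using wa[OF x] by (simp add: tau_def)
    next
      have nN: "n' \<le> N" by (simp add: N_def)
      have "a mod P n' < P N" using a by (metis le_less_trans mod_less_eq_dividend)
      then have wN: "vstep N (w a)" "vstep N (w ?a)" using a by (auto intro: vstep_w)
      show "integrable M (\<lambda>x. tau n' N y x *\<^sub>R (?f x * cnj (w a x)))"
        by (rule integrable_vstep[OF vstep_comp2[OF vstep_tau[OF nN] vstep_comp2[OF vstep_mono[OF f' nN] wN(1)]]])
      show "integrable M (\<lambda>x. tau n' N y x *\<^sub>R (?f x * cnj (w ?a x)))"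
        by (rule integrable_vstep[OF vstep_comp2[OF vstep_tau[OF nN] vstep_comp2[OF vstep_mono[OF f' nN] wN(2)]]])
    qed
    have "coeff ?f a = 0" using False by (intro coeff_vstep_eq_0[OF f']) simp
    then have "coeff u a = - coeff ?f ?a"
      unfolding cp(3) tw integral_tau[OF sel v] by (simp add: vilenkin_coeff_def)
    then show ?thesis by simp
  qed
  have "norm (S u m x) \<le> e * real B ^ q" for m x
  proof -
    have e0: "0 \<le> e" using e norm_ge_zero order_trans by blast
    have cf: "norm (coeff ?f a) \<le> e / P n" for a
    proof -
      have "norm (coeff ?f a) \<le> norm (g (real i / P n)) / P n"
        using norm_coeff_le[OF integrable_vstep[OF f]] integral_norm_piece[OF g i] by simp
      also have "\<dots> \<le> e / P n" using e by (intro divide_right_mono) auto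
      finally show ?thesis .
    qed
    have "norm (S u m x) \<le> (\<Sum>a<P N. norm (coeff u a))" by (rule norm_S_le_sum_coeff[OF cp(1)])
    also have "\<dots> \<le> (\<Sum>a<P N. norm (coeff ?f (a mod P n')))" by (intro sum_mono coeff_le) simp
    also have "\<dots> = (\<Sum>a<R * P n'. norm (coeff ?f (a mod P n')))" by (simp add: PN mult.commute)
    also have "\<dots> = (\<Sum>b<R. \<Sum>a<P n'. norm (coeff ?f a))"
      unfolding sum_lessThan_blocks by (intro sum.cong refl) simp
    \<comment> \<open>The nonzero coefficients stop at \<open>P n\<close>, not at
      \<open>P n'\<close>: this frees the bound from the rank reached by earlier pieces.\<close>
    also have "(\<Sum>a<P n'. norm (coeff ?f a)) = (\<Sum>a<P n. norm (coeff ?f a))"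
      by (rule sum.mono_neutral_right) (use P_mono[OF n'] coeff_vstep_eq_0[OF f] in auto)
    also have "(\<Sum>b<R. \<Sum>a<P n. norm (coeff ?f a)) \<le> (\<Sum>b<R. \<Sum>a<P n. e / P n)"
      by (intro sum_mono cf)
    also have "\<dots> = e * R" by simp
    also have "\<dots> \<le> e * real B ^ q" using R(3) e0 by (intro mult_left_mono) (simp_all flip: of_nat_power)
    finally show ?thesis .
  qed
  moreover have "measure M {x \<in> {0..<1}. idx n x = i \<and> u x \<noteq> g x} \<le> (1 / 2) ^ q / P n"
  proof -
    let ?one = "\<lambda>x. if idx n x = i then 1 else 0 :: real"
    have one: "vstep n ?one" using vstep_idx[of n n "\<lambda>j. if j = i then 1 else 0 :: real"] by simp
    have one': "vstep n' ?one" by (rule vstep_mono[OF one n'])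
    have nN: "n' \<le> N" by (simp add: N_def)
    have Q: "vstep N (\<lambda>x. idx n x = i \<and> u x \<noteq> g x)"
      by (rule vstep_comp2[OF vstep_idx vstep_comp2[OF cp(1) vstep_mono[OF g]]]) (use n' nN in auto)
    have t: "vstep N (\<lambda>x. tau n' N y x *\<^sub>R ?one x)"
      by (rule vstep_comp2[OF vstep_tau[OF nN] vstep_mono[OF one' nN]])
    have "measure M {x \<in> {0..<1}. idx n x = i \<and> u x \<noteq> g x} = (LINT x|M. (if idx n x = i \<and> u x \<noteq> g x then 1 else 0))"
      by (rule measure_vstep_set[OF Q])
    \<comment> \<open>Inside the cylinder \<open>u\<close> and \<open>g\<close> differ only where
      \<open>tau\<close> equals \<open>R\<close>.\<close>
    also have "\<dots> \<le> (LINT x|M. (1 / R) * (tau n' N y x *\<^sub>R ?one x))"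
    proof (rule integral_mono_unit)
      fix x :: real assume x: "x \<in> {0..<1}"
      show "(if idx n x = i \<and> u x \<noteq> g x then 1 else 0) \<le> (1 / R) * (tau n' N y x *\<^sub>R ?one x)"
        using x R0 by (auto simp: u_def correct_def piece_eq tau_def PN)
    qed (use integrable_vstep[OF t] integrable_vstep[OF vstep_comp[OF Q, of "\<lambda>b. if b then 1 else 0 :: real"]] in auto)
    also have "\<dots> = (1 / R) * (LINT x|M. tau n' N y x *\<^sub>R ?one x)" by (rule integral_mult_right_zero)
    also have "\<dots> = (1 / R) * (LINT x|M. ?one x)" by (simp only: integral_tau[OF sel one'])
    also have "(LINT x|M. ?one x) = 1 / P n"
    proof -
      have "(LINT x|M. ?one x) = (\<Sum>j<P n. if j = i then 1 / P n else 0)"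
        unfolding integral_vstep[OF one] by (intro sum.cong) auto
      then show ?thesis using i by simp
    qed
    also have "(1 / R) * (1 / P n) \<le> (1 / 2) ^ q * (1 / P n)"
    proof (rule mult_right_mono)
      have "2 ^ q \<le> real R" using R(2) by (metis of_nat_le_iff of_nat_numeral of_nat_power)
      then have "1 / real R \<le> 1 / 2 ^ q" by (intro divide_left_mono) (use R0 in auto)
      then show "1 / real R \<le> (1 / 2) ^ q" by (simp add: power_one_over)
    qed simp
    finally show ?thesis by simp
  qed
  moreover have "\<forall>x\<in>{0..<1}. idx n x \<noteq> i \<longrightarrow> u x = 0" by (simp add: u_def correct_supp)
  moreover have "n' \<le> N" by (simp add: N_def)
  ultimately show ?thesis using cp(1,2,4) by (intro exI[of _ N] exI[of _ u]) blast
qed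

text \<open>The tool for bounded functions, with no regard to where the change takes place. Placing
  the pieces by \<open>sequential_correction\<close> costs a factor 2 however many there are. Each
  piece is changed on at most the fraction \<open>(1 / 2) ^ q\<close> of its cylinder, and these
  fractions add up.\<close>

lemma small_correction:
  assumes g: "vstep n g" and e: "0 \<le> e" "\<And>x. x \<in> {0..<1} \<Longrightarrow> norm (g x) \<le> e"
  obtains v N where "n \<le> N" "vstep N v" "(LINT x|M. norm (v x)) \<le> 2 * (LINT x|M. norm (g x))"
    "\<And>x m. x \<in> {0..<1} \<Longrightarrow> norm (S v m x) \<le> 2 * (e * real B ^ q)"
    "measure M {x \<in> {0..<1}. v x \<noteq> g x} \<le> (1 / 2) ^ q"
proof -
  let ?Q = "\<lambda>i u. (\<forall>x\<in>{0..<1}. idx n x \<noteq> i \<longrightarrow> u x = 0) \<and>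
    (LINT x|M. norm (u x)) \<le> 2 * (LINT x|M. norm (piece n i g x)) \<and>
    (\<forall>m x. norm (S u m x) \<le> e * real B ^ q) \<and>
    measure M {x \<in> {0..<1}. idx n x = i \<and> u x \<noteq> g x} \<le> (1 / 2) ^ q / P n"
  have "\<exists>u N. n \<le> N \<and> (\<forall>i<P n. ?Q i (u i) \<and> vstep N (u i)) \<and>
     (\<forall>x\<in>{0..<1}. \<forall>e\<ge>0. (\<forall>i<P n. \<forall>m. norm (S (u i) m x) \<le> e) \<longrightarrow>
        (\<forall>m. norm (S (\<lambda>x. \<Sum>i<P n. u i x) m x) \<le> 2 * e))"
    by (rule sequential_correction) (rule small_piece[OF g], auto intro!: e(2) left_end_mem)
  then obtain u N where N: "n \<le> N" and u: "\<forall>i<P n. ?Q i (u i) \<and> vstep N (u i)"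
    and bd: "\<forall>x\<in>{0..<1}. \<forall>e\<ge>0. (\<forall>i<P n. \<forall>m. norm (S (u i) m x) \<le> e) \<longrightarrow>
        (\<forall>m. norm (S (\<lambda>x. \<Sum>i<P n. u i x) m x) \<le> 2 * e)" by (elim exE conjE) (rule that)
  define v where "v x = (\<Sum>i<P n. u i x)" for x
  have v: "vstep N v" unfolding v_def using u by (intro vstep_sum) simp
  interpret finite_measure M by (rule finite_M)
  show thesis
  proof (rule that[OF N v])
    have "(LINT x|M. norm (v x)) \<le> (\<Sum>i<P n. LINT x|M. norm (u i x))"
      unfolding v_def using u by (intro integral_norm_sum_le integrable_vstep[of N]) simp
    also have "\<dots> \<le> (\<Sum>i<P n. 2 * (LINT x|M. norm (piece n i g x)))" using u by (intro sum_mono) simp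
    also have "\<dots> = 2 * (LINT x|M. norm (g x))" by (simp only: sum_distrib_left[symmetric] sum_integral_pieces[OF g])
    finally show "(LINT x|M. norm (v x)) \<le> 2 * (LINT x|M. norm (g x))" .
  next
    fix x :: real and m assume x: "x \<in> {0..<1}"
    have "0 \<le> e * real B ^ q" using e(1) by simp
    then have "\<forall>m. norm (S (\<lambda>x. \<Sum>i<P n. u i x) m x) \<le> 2 * (e * real B ^ q)"
      using bd[rule_format, OF x, of "e * real B ^ q"] u by blast
    then show "norm (S v m x) \<le> 2 * (e * real B ^ q)" unfolding v_def by blast
  next
    let ?F = "\<lambda>i. {x \<in> {0..<1}. idx n x = i \<and> u i x \<noteq> g x}"
    have F: "?F i \<in> sets M" if "i < P n" for i
      by (rule measure_vstep_set(1)[of N], rule vstep_comp2[OF vstep_idx vstep_comp2[OF _ vstep_mono[OF g]]])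
        (use that N u in auto)
    have sub: "{x \<in> {0..<1}. v x \<noteq> g x} \<subseteq> (\<Union>i<P n. ?F i)"
    proof
      fix x assume x: "x \<in> {x \<in> {0..<1}. v x \<noteq> g x}"
      then have "v x = u (idx n x) x" unfolding v_def using u by (intro sum_pieces_eq) auto
      then show "x \<in> (\<Union>i<P n. ?F i)" using x idx_less[of x n] by auto
    qed
    have "measure M {x \<in> {0..<1}. v x \<noteq> g x} \<le> measure M (\<Union>i<P n. ?F i)"
      using F by (intro finite_measure_mono[OF sub]) auto
    also have "\<dots> \<le> (\<Sum>i<P n. measure M (?F i))"
      using F by (intro finite_measure_subadditive_finite) auto
    also have "\<dots> \<le> (\<Sum>i<P n. (1 / 2) ^ q / P n)" using u by (intro sum_mono) simp
    also have "\<dots> = (1 / 2) ^ q" by simp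
    finally show "measure M {x \<in> {0..<1}. v x \<noteq> g x} \<le> (1 / 2) ^ q" .
  qed
qed

text \<open>With subcylinders inside \<open>G\<close> nothing changes off \<open>G\<close>, but the
  sums are controlled only at zeros of \<open>g\<close>. There the piece of the point's own cylinder
  is identically zero, and all others obey \<open>weak_type_off_cyl\<close>; the measures of their
  exceptional sets add up because the norms of the pieces do.\<close>

lemma set_correction:
  assumes g: "vstep n g" and l: "0 < l"
    and G: "\<And>n'. \<exists>N y. selects n' N y \<and> (\<forall>l<P n'. cyl N (y l) \<subseteq> G)"
  obtains v N F where "vstep N v" "\<And>x. x \<in> {0..<1} \<Longrightarrow> x \<notin> G \<Longrightarrow> v x = g x"
    "(LINT x|M. norm (v x)) \<le> 2 * (LINT x|M. norm (g x))"
    "F \<in> sets M" "measure M F \<le> 2 * B * (LINT x|M. norm (g x)) / l"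
    "\<And>x m. x \<in> {0..<1} \<Longrightarrow> x \<notin> F \<Longrightarrow> g x = 0 \<Longrightarrow> norm (S v m x) \<le> 2 * l"
proof -
  let ?Q = "\<lambda>i u. (\<forall>x\<in>{0..<1}. idx n x \<noteq> i \<longrightarrow> u x = 0) \<and>
    (LINT x|M. norm (u x)) \<le> 2 * (LINT x|M. norm (piece n i g x)) \<and>
    (\<forall>x\<in>{0..<1}. x \<notin> G \<longrightarrow> idx n x = i \<longrightarrow> u x = g x) \<and>
    (g (real i / P n) = 0 \<longrightarrow> u = (\<lambda>x. 0))"
  have step: "\<exists>N u. n' \<le> N \<and> vstep N u \<and> (\<forall>a<P n'. coeff u a = 0) \<and> ?Q i u" if i: "i < P n" and n': "n \<le> n'" for i n'
  proof -
    obtain N y where y: "selects n' N y" "\<And>l. l < P n' \<Longrightarrow> cyl N (y l) \<subseteq> G" using G by blast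
    define u where "u = correct n' N y (piece n i g)"
    note cp = correct_props[OF y(1) vstep_mono[OF vstep_piece[OF g, of i] n'], folded u_def]
    have "u x = g x" if x: "x \<in> {0..<1}" "x \<notin> G" "idx n x = i" for x
    proof -
      have "x \<notin> cyl N (y (idx n' x))" using y(2)[OF idx_less[OF x(1)]] x(2) by blast
      then have "idx N x \<noteq> y (idx n' x)" using idx_eq_iff[of x N] x(1) by auto
      then show ?thesis using x by (simp add: u_def correct_def tau_def piece_eq)
    qed
    moreover have "u = (\<lambda>x. 0)" if "g (real i / P n) = 0"
      unfolding u_def piece_eq_0[OF g i that] correct_def by simp
    moreover have "n' \<le> N" using y(1) by (simp add: selects_def)
    moreover have "\<forall>x\<in>{0..<1}. idx n x \<noteq> i \<longrightarrow> u x = 0" by (simp add: u_def correct_supp)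
    ultimately show ?thesis using cp(1,2,4) by (intro exI[of _ N] exI[of _ u]) blast
  qed
  have "\<exists>u N. n \<le> N \<and> (\<forall>i<P n. ?Q i (u i) \<and> vstep N (u i)) \<and>
     (\<forall>x\<in>{0..<1}. \<forall>e\<ge>0. (\<forall>i<P n. \<forall>m. norm (S (u i) m x) \<le> e) \<longrightarrow>
        (\<forall>m. norm (S (\<lambda>x. \<Sum>i<P n. u i x) m x) \<le> 2 * e))"
    by (rule sequential_correction) (rule step, auto)
  then obtain u N where N: "n \<le> N" and u: "\<forall>i<P n. ?Q i (u i) \<and> vstep N (u i)"
    and bd: "\<forall>x\<in>{0..<1}. \<forall>e\<ge>0. (\<forall>i<P n. \<forall>m. norm (S (u i) m x) \<le> e) \<longrightarrow>
        (\<forall>m. norm (S (\<lambda>x. \<Sum>i<P n. u i x) m x) \<le> 2 * e)" by (elim exE conjE) (rule that)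
  define v where "v x = (\<Sum>i<P n. u i x)" for x
  have v: "vstep N v" unfolding v_def using u by (intro vstep_sum) simp
  have "\<exists>F. F \<in> sets M \<and> measure M F \<le> B * (LINT y|M. norm (u i y)) / l \<and>
      (\<forall>x m. x \<in> {0..<1} \<longrightarrow> x \<notin> F \<longrightarrow> idx n x \<noteq> i \<longrightarrow> norm (S (u i) m x) \<le> l)" if i: "i < P n" for i
  proof -
    have int: "integrable M (u i)" using u i by (intro integrable_vstep[of N]) simp
    have supp: "u i x = 0" if "x \<in> {0..<1}" "idx n x \<noteq> i" for x using u i that by blast
    show ?thesis by (rule weak_type_off_cyl[OF i int l supp]) (assumption, assumption, blast)
  qed
  then obtain F where F: "\<And>i. i < P n \<Longrightarrow> F i \<in> sets M"
      "\<And>i. i < P n \<Longrightarrow> measure M (F i) \<le> B * (LINT y|M. norm (u i y)) / l"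
      "\<And>i x m. i < P n \<Longrightarrow> x \<in> {0..<1} \<Longrightarrow> x \<notin> F i \<Longrightarrow> idx n x \<noteq> i \<Longrightarrow> norm (S (u i) m x) \<le> l"
    by metis
  have int_u: "(\<Sum>i<P n. LINT x|M. norm (u i x)) \<le> 2 * (LINT x|M. norm (g x))"
  proof -
    have "(\<Sum>i<P n. LINT x|M. norm (u i x)) \<le> (\<Sum>i<P n. 2 * (LINT x|M. norm (piece n i g x)))"
      using u by (intro sum_mono) simp
    then show ?thesis by (simp only: sum_distrib_left[symmetric] sum_integral_pieces[OF g])
  qed
  interpret finite_measure M by (rule finite_M)
  show thesis
  proof (rule that[OF v])
    fix x assume x: "x \<in> {0..<1}" "x \<notin> G"
    then have "v x = u (idx n x) x" unfolding v_def using u by (intro sum_pieces_eq) auto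
    then show "v x = g x" using u x idx_less[OF x(1), of n] by simp
  next
    have "(LINT x|M. norm (v x)) \<le> (\<Sum>i<P n. LINT x|M. norm (u i x))"
      unfolding v_def using u by (intro integral_norm_sum_le integrable_vstep[of N]) simp
    then show "(LINT x|M. norm (v x)) \<le> 2 * (LINT x|M. norm (g x))" using int_u by simp
  next
    show "(\<Union>i<P n. F i) \<in> sets M" using F(1) by auto
    have "measure M (\<Union>i<P n. F i) \<le> (\<Sum>i<P n. measure M (F i))"
      using F(1) by (intro finite_measure_subadditive_finite) auto
    also have "\<dots> \<le> (\<Sum>i<P n. B * (LINT y|M. norm (u i y)) / l)" using F(2) by (intro sum_mono) simp
    also have "\<dots> = B / l * (\<Sum>i<P n. LINT y|M. norm (u i y))" by (simp add: sum_distrib_left)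
    also have "\<dots> \<le> B / l * (2 * (LINT x|M. norm (g x)))" using l by (intro mult_left_mono int_u) simp
    finally show "measure M (\<Union>i<P n. F i) \<le> 2 * B * (LINT x|M. norm (g x)) / l" by (simp add: mult_ac)
  next
    fix x m assume x: "x \<in> {0..<1}" "x \<notin> (\<Union>i<P n. F i)" "g x = 0"
    have "norm (S (u i) m x) \<le> l" if i: "i < P n" for i m
    proof (cases "idx n x = i")
      case True
      have "g (real i / P n) = 0" using vstep_left_end[OF g x(1)] x(3) True by simp
      then have "u i = (\<lambda>x. 0)" using u i by blast
      then show ?thesis using l by (simp add: vilenkin_partial_sum_def vilenkin_coeff_def)
    qed (use F(3)[OF i x(1)] x(2) i in blast)
    then have "\<forall>m. norm (S (\<lambda>x. \<Sum>i<P n. u i x) m x) \<le> 2 * l"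
      using bd[rule_format, OF x(1), of l] l by (meson less_imp_le)
    then show "norm (S v m x) \<le> 2 * l" unfolding v_def by blast
  qed
qed

text \<open>Two corrections in succession. Values of size at most \<open>e\<close> are handled by
  \<open>small_correction\<close>. The rest of \<open>g\<close> lives where that correction changed
  something or where \<open>g\<close> is large, a set of small measure, and is handled by
  \<open>set_correction\<close> inside \<open>G\<close>.\<close>

lemma correction:
  assumes g: "vstep n g" and e: "0 < e" and l: "0 < l"
    and G: "\<And>n'. \<exists>N y. selects n' N y \<and> (\<forall>l<P n'. cyl N (y l) \<subseteq> G)"
  obtains u N F where "vstep N u" "\<And>x. x \<in> {0..<1} \<Longrightarrow> x \<notin> G \<Longrightarrow> u x = g x"
    "(LINT x|M. norm (u x)) \<le> 8 * (LINT x|M. norm (g x))" "F \<in> sets M"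
    "measure M F \<le> (1 / 2) ^ q + (LINT x|M. norm (g x)) / e + 6 * real B * (LINT x|M. norm (g x)) / l"
    "\<And>x m. x \<in> {0..<1} \<Longrightarrow> x \<notin> F \<Longrightarrow> norm (S u m x) \<le> 2 * (e * real B ^ q) + 2 * l"
proof -
  define A where "A = (LINT x|M. norm (g x))"
  define g' where "g' x = (if norm (g x) \<le> e then g x else 0)" for x
  have g': "vstep n g'" unfolding g'_def by (rule vstep_comp[OF g])
  have intg: "integrable M g" by (rule integrable_vstep[OF g])
  have g'_le: "norm (g' x) \<le> e" for x using e by (simp add: g'_def)
  obtain v N1 where N1: "n \<le> N1" and v: "vstep N1 v"
    and v_int: "(LINT x|M. norm (v x)) \<le> 2 * (LINT x|M. norm (g' x))"
    and v_S: "\<And>x m. x \<in> {0..<1} \<Longrightarrow> norm (S v m x) \<le> 2 * (e * real B ^ q)"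
    and v_ne: "measure M {x \<in> {0..<1}. v x \<noteq> g' x} \<le> (1 / 2) ^ q"
    by (rule small_correction[OF g' less_imp_le[OF e] g'_le, of q]) blast
  have intv: "integrable M v" by (rule integrable_vstep[OF v])
  have g'_le_g: "norm (g' x) \<le> norm (g x)" for x by (simp add: g'_def)
  have "(LINT x|M. norm (g' x)) \<le> A"
    unfolding A_def by (intro integral_mono integrable_norm g'_le_g intg integrable_vstep[OF g'])
  with v_int have v_int: "(LINT x|M. norm (v x)) \<le> 2 * A" by simp
  define r where "r x = g x - v x" for x
  have r: "vstep N1 r" unfolding r_def by (rule vstep_comp2[OF vstep_mono[OF g N1] v])
  have "(LINT x|M. norm (r x)) \<le> (LINT x|M. norm (g x) + norm (v x))"
    using intg intv integrable_vstep[OF r] unfolding r_def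
    by (intro integral_mono norm_triangle_ineq4) auto
  also have "\<dots> \<le> 3 * A" using intg intv v_int by (simp add: A_def)
  finally have r_int: "(LINT x|M. norm (r x)) \<le> 3 * A" .
  obtain u' N2 F' where u': "vstep N2 u'" and u'_G: "\<And>x. x \<in> {0..<1} \<Longrightarrow> x \<notin> G \<Longrightarrow> u' x = r x"
    and u'_int: "(LINT x|M. norm (u' x)) \<le> 2 * (LINT x|M. norm (r x))"
    and F': "F' \<in> sets M" "measure M F' \<le> 2 * B * (LINT x|M. norm (r x)) / l"
    and u'_S: "\<And>x m. x \<in> {0..<1} \<Longrightarrow> x \<notin> F' \<Longrightarrow> r x = 0 \<Longrightarrow> norm (S u' m x) \<le> 2 * l"
    by (rule set_correction[OF r l G]) blast
  have intu': "integrable M u'" by (rule integrable_vstep[OF u'])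
  \<comment> \<open>On [0,1) off these two sets \<open>v = g' = g\<close>, so \<open>r\<close>
    vanishes and \<open>u'_S\<close> applies.\<close>
  let ?F1 = "{x \<in> {0..<1}. v x \<noteq> g' x}" and ?F2 = "{x \<in> {0..<1}. e < norm (g x)}"
  have F1: "?F1 \<in> sets M"
    by (rule measure_vstep_set(1)[OF vstep_comp2[OF v vstep_mono[OF g' N1]]])
  have F2s: "vstep n (\<lambda>x. e < norm (g x))" by (rule vstep_comp[OF g])
  have F2: "?F2 \<in> sets M" by (rule measure_vstep_set(1)[OF F2s])
  have mF2: "measure M ?F2 \<le> A / e"
  proof -
    have "measure M ?F2 = (LINT x|M. (if e < norm (g x) then 1 else 0))" by (rule measure_vstep_set(2)[OF F2s])
    also have "\<dots> \<le> (LINT x|M. norm (g x) / e)"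
      using e intg integrable_vstep[OF vstep_comp[OF F2s, of "\<lambda>b. if b then 1 else 0 :: real"]]
      by (intro integral_mono) (auto simp: field_simps)
    finally show ?thesis by (simp add: A_def)
  qed
  have mF': "measure M F' \<le> 6 * real B * A / l"
  proof -
    have "2 * real B * (LINT x|M. norm (r x)) / l \<le> 2 * real B * (3 * A) / l"
      using l r_int by (intro divide_right_mono mult_left_mono) auto
    then show ?thesis using F'(2) by simp
  qed
  interpret finite_measure M by (rule finite_M)
  show thesis
  proof (rule that[of "max N1 N2" "\<lambda>x. v x + u' x" "?F1 \<union> ?F2 \<union> F'"])
    show "vstep (max N1 N2) (\<lambda>x. v x + u' x)"
      by (rule vstep_comp2[OF vstep_mono[OF v] vstep_mono[OF u']]) auto
    show "v x + u' x = g x" if "x \<in> {0..<1}" "x \<notin> G" for x using u'_G[OF that] by (simp add: r_def)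
    have "(LINT x|M. norm (v x + u' x)) \<le> (LINT x|M. norm (v x) + norm (u' x))"
      using intv intu' by (intro integral_mono norm_triangle_ineq) auto
    also have "\<dots> = (LINT x|M. norm (v x)) + (LINT x|M. norm (u' x))" using intv intu' by simp
    \<comment> \<open>At most \<open>2 * A\<close> comes from \<open>v\<close>, and twice the
      \<open>3 * A\<close> of \<open>r\<close> from \<open>u'\<close>.\<close>
    also have "\<dots> \<le> 8 * A" using v_int u'_int r_int by linarith
    finally show "(LINT x|M. norm (v x + u' x)) \<le> 8 * (LINT x|M. norm (g x))" by (simp add: A_def)
    show "?F1 \<union> ?F2 \<union> F' \<in> sets M" using F1 F2 F' by auto
    have "measure M (?F1 \<union> ?F2 \<union> F') \<le> measure M (?F1 \<union> ?F2) + measure M F'"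
      using F1 F2 F' by (intro measure_Un_le) auto
    also have "\<dots> \<le> measure M ?F1 + measure M ?F2 + measure M F'"
      using F1 F2 by (intro add_right_mono measure_Un_le) auto
    also have "\<dots> \<le> (1 / 2) ^ q + A / e + 6 * real B * A / l" using v_ne mF2 mF' by linarith
    finally show "measure M (?F1 \<union> ?F2 \<union> F') \<le> (1 / 2) ^ q + (LINT x|M. norm (g x)) / e + 6 * real B * (LINT x|M. norm (g x)) / l"
      by (simp add: A_def)
    fix x m assume x: "x \<in> {0..<1}" "x \<notin> ?F1 \<union> ?F2 \<union> F'"
    then have "r x = 0" by (auto simp: r_def g'_def)
    then have "norm (S u' m x) \<le> 2 * l" using x by (intro u'_S) auto
    then have "norm (S v m x + S u' m x) \<le> 2 * (e * real B ^ q) + 2 * l"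
      by (intro order_trans[OF norm_triangle_ineq] add_mono v_S[OF x(1)])
    then show "norm (S (\<lambda>x. v x + u' x) m x) \<le> 2 * (e * real B ^ q) + 2 * l"
      by (simp only: S_add[OF intv intu'])
  qed
qed

text \<open>The constants are fixed in the order \<open>q\<close>, then \<open>e\<close> and
  \<open>l\<close>, then \<open>d\<close>, independently of the rank and of the function. The
  approximating step functions can therefore be chosen after all thresholds.\<close>

lemma uniform_correction:
  assumes t: "0 < t" and G: "\<And>n'. \<exists>N y. selects n' N y \<and> (\<forall>l<P n'. cyl N (y l) \<subseteq> G)"
  shows "\<exists>d>0. \<forall>n g. vstep n g \<longrightarrow> (LINT x|M. norm (g x)) \<le> d \<longrightarrow>
    (\<exists>u N F. vstep N u \<and> (\<forall>x\<in>{0..<1}. x \<notin> G \<longrightarrow> u x = g x) \<and>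
      (LINT x|M. norm (u x)) \<le> 8 * (LINT x|M. norm (g x)) \<and> F \<in> sets M \<and> measure M F \<le> t \<and>
      (\<forall>x\<in>{0..<1}. x \<notin> F \<longrightarrow> (\<forall>m. norm (S u m x) \<le> t)))"
proof -
  obtain q where q: "(1 / 2 :: real) ^ q < t / 3" using real_arch_pow_inv[of "t / 3" "1 / 2"] t by auto
  have B: "0 < real B" using B_ge_2 by simp
  \<comment> \<open>These choices make both terms of the bound on partial sums equal to
    \<open>t / 2\<close>.\<close>
  define e where "e = t / (4 * real B ^ q)"
  define l where "l = t / 4"
  have e: "0 < e" and l: "0 < l" using t B by (auto simp: e_def l_def)
  have el: "2 * (e * real B ^ q) + 2 * l = t" using B by (simp add: e_def l_def)
  \<comment> \<open>Makes each of the two terms of the exceptional measure that contain the norm at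
    most \<open>t / 3\<close>.\<close>
  define d where "d = min (e * t / 3) (l * t / (18 * real B))"
  have "0 < d" using e l t B by (simp add: d_def)
  moreover have "\<exists>u N F. vstep N u \<and> (\<forall>x\<in>{0..<1}. x \<notin> G \<longrightarrow> u x = g x) \<and>
      (LINT x|M. norm (u x)) \<le> 8 * (LINT x|M. norm (g x)) \<and> F \<in> sets M \<and> measure M F \<le> t \<and>
      (\<forall>x\<in>{0..<1}. x \<notin> F \<longrightarrow> (\<forall>m. norm (S u m x) \<le> t))"
    if g: "vstep n g" and gd: "(LINT x|M. norm (g x)) \<le> d" for n g
  proof -
    obtain u N F where u: "vstep N u" "\<And>x. x \<in> {0..<1} \<Longrightarrow> x \<notin> G \<Longrightarrow> u x = g x"
      "(LINT x|M. norm (u x)) \<le> 8 * (LINT x|M. norm (g x))" "F \<in> sets M"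
      "measure M F \<le> (1 / 2) ^ q + (LINT x|M. norm (g x)) / e + 6 * real B * (LINT x|M. norm (g x)) / l"
      "\<And>x m. x \<in> {0..<1} \<Longrightarrow> x \<notin> F \<Longrightarrow> norm (S u m x) \<le> 2 * (e * real B ^ q) + 2 * l"
      by (rule correction[OF g e l G, of q]) blast
    have "(LINT x|M. norm (g x)) / e \<le> t / 3" using gd e by (simp add: d_def field_simps)
    moreover have "6 * real B * (LINT x|M. norm (g x)) / l \<le> t / 3" using gd l B by (simp add: d_def field_simps)
    ultimately have "measure M F \<le> t" using u(5) q by linarith
    then show ?thesis using u unfolding el by blast
  qed
  ultimately show ?thesis by blast
qed

section \<open>Cylinders shrinking to a point, and subcylinders inside a dense open set\<close>

lemma mem_cyl_idx: "0 \<le> x \<Longrightarrow> x \<in> cyl n (idx n x)"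
  using idx_eq_iff[of x n "idx n x"] by simp

lemma cyl_subset_ball:
  assumes "0 \<le> x" "1 / P N < r"
  shows "cyl N (idx N x) \<subseteq> ball x r"
proof
  fix z assume z: "z \<in> cyl N (idx N x)"
  have "x \<in> cyl N (idx N x)" by (rule mem_cyl_idx[OF assms(1)])
  then have "\<bar>x - z\<bar> < (real (idx N x) + 1) / P N - real (idx N x) / P N"
    using z unfolding cyl_def atLeastLessThan_iff by linarith
  also have "\<dots> = 1 / P N" by (simp add: diff_divide_distrib[symmetric])
  finally show "z \<in> ball x r" using assms(2) by (simp add: dist_real_def)
qed

lemma eventually_cyl_subset_ball:
  assumes "0 \<le> x" "0 < r"
  shows "\<exists>N0. \<forall>N\<ge>N0. cyl N (idx N x) \<subseteq> ball x r"
proof -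
  obtain N0 :: nat where N0: "1 / r < N0" using reals_Archimedean2 by blast
  have "1 / P N < r" if "N0 \<le> N" for N
  proof -
    have "1 / r < P N" using N0 that less_P[of N] by linarith
    then show ?thesis using assms(2) by (simp add: field_simps)
  qed
  then show ?thesis using cyl_subset_ball[OF assms(1)] by blast
qed

text \<open>The interior of each cylinder meets \<open>G\<close>, and around a common point all
  cylinders of large rank lie in both. As there are finitely many cylinders of rank
  \<open>n\<close>, one rank \<open>N\<close> serves them all.\<close>

lemma dense_open_selects:
  assumes op: "openin (top_of_set {0..1}) G" and dns: "{0..1} \<subseteq> closure G"
  shows "\<exists>N y. selects n N y \<and> (\<forall>l<P n. cyl N (y l) \<subseteq> G)"
proof -
  obtain T where T: "open T" "G = {0..1} \<inter> T" using op by (auto simp: openin_open)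
  have "\<exists>N0. \<forall>N\<ge>N0. \<exists>j<P N. cyl N j \<subseteq> cyl n l \<inter> G" if l: "l < P n" for l
  proof -
    define U where "U = {real l / P n <..< (real l + 1) / P n}"
    have U: "open U" "U \<subseteq> cyl n l" by (auto simp: U_def cyl_def)
    have U01: "U \<subseteq> {0..<1}" using U(2) cyl_subset[OF l] by (rule subset_trans)
    have "real l / P n < (real l + 1) / P n" by (simp add: divide_strict_right_mono)
    then obtain z where z: "z \<in> U" unfolding U_def by (metis dense greaterThanLessThan_iff)
    then have "z \<in> closure G" using U01 dns by force
    then have "U \<inter> G \<noteq> {}" using z U(1) open_Int_closure_eq_empty by blast
    then obtain x where x: "x \<in> U" "x \<in> T" using T by auto
    then obtain r where r: "0 < r" "ball x r \<subseteq> U \<inter> T"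
      using openE[OF open_Int[OF U(1) T(1)], of x] by blast
    have x01: "x \<in> {0..<1}" using U01 x by auto
    obtain N0 where N0: "\<And>N. N \<ge> N0 \<Longrightarrow> cyl N (idx N x) \<subseteq> ball x r"
      using eventually_cyl_subset_ball[of x r] x01 r by auto
    have "ball x r \<subseteq> cyl n l \<inter> G" using r(2) U(2) U01 T(2) by force
    then show ?thesis using N0 idx_less[OF x01] by (meson subset_trans)
  qed
  then obtain N0 where N0: "\<And>l N. l < P n \<Longrightarrow> N0 l \<le> N \<Longrightarrow> \<exists>j<P N. cyl N j \<subseteq> cyl n l \<inter> G" by metis
  \<comment> \<open>A rank beyond all thresholds \<open>N0 l\<close>; the summand \<open>n\<close>
    ensures \<open>n \<le> N\<close>.\<close>
  define N where "N = n + (\<Sum>l<P n. N0 l)"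
  have "\<exists>j. j < P N \<and> cyl N j \<subseteq> cyl n l \<inter> G" if "l < P n" for l
  proof -
    have "N0 l \<le> (\<Sum>l<P n. N0 l)" using that by (intro member_le_sum) auto
    then show ?thesis using N0[OF that, of N] by (auto simp: N_def)
  qed
  then obtain y where "\<And>l. l < P n \<Longrightarrow> y l < P N \<and> cyl N (y l) \<subseteq> cyl n l \<inter> G" by metis
  then have "selects n N y \<and> (\<forall>l<P n. cyl N (y l) \<subseteq> G)" unfolding selects_def by (auto simp: N_def)
  then show ?thesis by blast
qed

subsection \<open>Approximation and assembly\<close>

text \<open>\<open>A\<close> is replaced by an open set \<open>T\<close> of nearly the same measure,
  and \<open>T\<close> by the union of the cylinders of rank \<open>n\<close> inside it. Every point
  of \<open>T\<close> in [0,1) is eventually captured, so dominated convergence applies.\<close>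

lemma indicator_vstep_approx:
  assumes A: "A \<in> sets M" and e: "0 < e"
  shows "\<exists>n (s :: real \<Rightarrow> real). vstep n s \<and> (LINT x|M. \<bar>indicator A x - s x\<bar>) < e"
proof -
  interpret finite_measure M by (rule finite_M)
  have A': "A \<in> sets lebesgue" "A \<subseteq> {0..1}" using A by (auto simp: sets_restrict_space_iff)
  obtain T where T: "open T" "A \<subseteq> T" "T - A \<in> lmeasurable" "emeasure lebesgue (T - A) < ennreal (e / 2)"
    using sets_lebesgue_outer_open[OF A'(1), of "e / 2"] e by auto
  let ?T = "T \<inter> {0..1}"
  have Ts: "?T \<in> sets M" using T(1) by (simp add: sets_restrict_space_iff)
  have iT: "integrable M (indicator ?T :: real \<Rightarrow> real)" and iA: "integrable M (indicator A :: real \<Rightarrow> real)"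
    using A Ts by (auto intro!: integrable_real_indicator simp: top.not_eq_extremum[symmetric])
  have AT: "(LINT x|M. \<bar>indicator A x - indicator ?T x :: real\<bar>) < e / 2"
  proof -
    have "(LINT x|M. \<bar>indicator A x - indicator ?T x :: real\<bar>) = (LINT x|M. indicator (?T - A) x)"
      using T(2) A'(2) by (intro Bochner_Integration.integral_cong) (auto simp: indicator_def)
    also have "\<dots> = measure M (?T - A)" by (simp add: Int_absorb2 subset_eq)
    also have "\<dots> = measure lebesgue (?T - A)" by (intro measure_restrict_space) auto
    also have "\<dots> \<le> measure lebesgue (T - A)"
      using T(3) A' T(1) by (intro measure_mono_fmeasurable) auto
    also have "\<dots> < e / 2" using T(4) T(3) e by (simp add: emeasure_eq_measure2 ennreal_less_iff)
    finally show ?thesis .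
  qed
  define s where "s n x = (if cyl n (idx n x) \<subseteq> T then 1 else 0 :: real)" for n x
  have s: "vstep n (s n)" for n
    unfolding s_def by (rule vstep_idx[of n n "\<lambda>j. if cyl n j \<subseteq> T then 1 else 0"]) simp
  have "(\<lambda>n. LINT x|M. \<bar>indicator ?T x - s n x\<bar>) \<longlonglongrightarrow> (LINT x|M. 0)"
  proof (rule integral_dominated_convergence[where w = "\<lambda>_. 1"])
    show "AE x in M. (\<lambda>n. \<bar>indicator ?T x - s n x\<bar>) \<longlonglongrightarrow> 0"
      using AE_M_unit
    proof eventually_elim
      fix x :: real assume x: "x \<in> {0..<1}"
      show "(\<lambda>n. \<bar>indicator ?T x - s n x\<bar>) \<longlonglongrightarrow> 0"
      proof (cases "x \<in> T")
        case True
        obtain r where r: "0 < r" "ball x r \<subseteq> T" using openE[OF T(1) True] by blast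
        obtain N0 where "\<And>N. N \<ge> N0 \<Longrightarrow> cyl N (idx N x) \<subseteq> ball x r"
          using eventually_cyl_subset_ball[of x r] x r by auto
        then have "\<forall>\<^sub>F n in sequentially. \<bar>indicator ?T x - s n x\<bar> = 0"
          using True x r(2) unfolding eventually_sequentially s_def by (intro exI[of _ N0]) auto
        then show ?thesis by (rule tendsto_eventually)
      next
        case False
        have "x \<in> cyl n (idx n x)" for n using x by (simp add: mem_cyl_idx)
        then have "s n x = 0" for n using False by (auto simp: s_def)
        then show ?thesis using False by simp
      qed
    qed
    show "(\<lambda>x. \<bar>indicator ?T x - s n x\<bar>) \<in> borel_measurable M" for n
      using iT integrable_vstep[OF s[of n]] by (intro borel_measurable_integrable) auto
  qed (auto simp: s_def indicator_def)
  then have "\<forall>\<^sub>F n in sequentially. (LINT x|M. \<bar>indicator ?T x - s n x\<bar>) < e / 2"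
    using e by (intro order_tendstoD) auto
  then obtain n where n: "(LINT x|M. \<bar>indicator ?T x - s n x\<bar>) < e / 2"
    using eventually_happens'[OF sequentially_bot] by blast
  have i1: "integrable M (\<lambda>x. \<bar>indicator A x - indicator ?T x :: real\<bar>)"
    and i2: "integrable M (\<lambda>x. \<bar>indicator ?T x - s n x\<bar>)"
    and i3: "integrable M (\<lambda>x. \<bar>indicator A x - s n x\<bar>)"
    using iA iT integrable_vstep[OF s[of n]] by auto
  have "(LINT x|M. \<bar>indicator A x - s n x\<bar>) \<le> (LINT x|M. \<bar>indicator A x - indicator ?T x :: real\<bar> + \<bar>indicator ?T x - s n x\<bar>)"
    using i1 i2 i3 by (intro integral_mono) auto
  also have "\<dots> < e" using AT n i1 i2 by simp
  finally show ?thesis using s by blast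
qed

lemma vstep_dense:
  assumes "integrable M (f :: real \<Rightarrow> complex)" and "0 < e"
  shows "\<exists>n s. vstep n s \<and> (LINT x|M. norm (f x - s x)) < e"
  using assms
proof (induction arbitrary: e rule: integrable_induct)
  case (base A c)
  \<comment> \<open>The added 1 allows \<open>c = 0\<close>.\<close>
  have "0 < e / (norm c + 1)" using base by (simp add: add_nonneg_pos)
  then obtain n s where s: "vstep n s" "(LINT x|M. \<bar>indicator A x - s x\<bar>) < e / (norm c + 1)"
    using indicator_vstep_approx[OF base(1)] by blast
  have eq: "norm (indicator A x *\<^sub>R c - s x *\<^sub>R c) = \<bar>indicator A x - s x\<bar> * norm c" for x
    by (simp add: scaleR_diff_left[symmetric])
  have "(LINT x|M. norm (indicator A x *\<^sub>R c - s x *\<^sub>R c)) = (LINT x|M. \<bar>indicator A x - s x\<bar>) * norm c"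
    unfolding eq by simp
  also have "\<dots> \<le> (LINT x|M. \<bar>indicator A x - s x\<bar>) * (norm c + 1)" by (intro mult_left_mono) auto
  also have "\<dots> < e" using s(2) by (simp add: pos_less_divide_eq add_nonneg_pos)
  finally show ?case using vstep_comp[OF s(1), of "\<lambda>t. t *\<^sub>R c"] by blast
next
  case (add f g)
  have e2: "0 < e / 2" using add.prems by simp
  from add.IH(1)[OF e2] obtain n s where s: "vstep n s" "(LINT x|M. norm (f x - s x)) < e / 2"
    by (elim exE conjE)
  from add.IH(2)[OF e2] obtain n' s' where s': "vstep n' s'" "(LINT x|M. norm (g x - s' x)) < e / 2"
    by (elim exE conjE)
  have int: "integrable M s" "integrable M s'" using s s' by (auto intro: integrable_vstep)
  have "(LINT x|M. norm (f x + g x - (s x + s' x))) \<le> (LINT x|M. norm (f x - s x) + norm (g x - s' x))"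
    using add.hyps int by (intro integral_mono) (auto intro: norm_diff_triangle_ineq)
  also have "\<dots> < e" using s(2) s'(2) add.hyps int by simp
  finally show ?case
    using vstep_comp2[OF vstep_mono[OF s(1), of "max n n'"] vstep_mono[OF s'(1), of "max n n'"], of "(+)"] by auto
next
  case (lim f s)
  have "(\<lambda>i. LINT x|M. norm (f x - s i x)) \<longlonglongrightarrow> (LINT x|M. 0)"
  \<comment> \<open>The induction rule provides \<open>norm (s i x) \<le> 2 * norm (f x)\<close>,
    hence the factor 3.\<close>
  proof (rule integral_dominated_convergence[where w = "\<lambda>x. 3 * norm (f x)"])
    show "AE x in M. (\<lambda>i. norm (f x - s i x)) \<longlonglongrightarrow> 0"
    proof (rule AE_I2)
      fix x assume "x \<in> space M"
      then have "(\<lambda>i. f x - s i x) \<longlonglongrightarrow> f x - f x" by (intro tendsto_diff tendsto_const lim.hyps)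
      then show "(\<lambda>i. norm (f x - s i x)) \<longlonglongrightarrow> 0" using tendsto_norm_zero by force
    qed
    show "AE x in M. norm (norm (f x - s i x)) \<le> 3 * norm (f x)" for i
    proof (rule AE_I2)
      fix x assume "x \<in> space M"
      then show "norm (norm (f x - s i x)) \<le> 3 * norm (f x)"
        using lim.hyps(3)[of x i] norm_triangle_ineq4[of "f x" "s i x"] by simp
    qed
  qed (use lim.hyps in auto)
  then have "\<forall>\<^sub>F i in sequentially. (LINT x|M. norm (f x - s i x)) < e / 2"
    using lim.prems by (intro order_tendstoD) auto
  then obtain i where i: "(LINT x|M. norm (f x - s i x)) < e / 2"
    using eventually_happens'[OF sequentially_bot] by blast
  obtain n t where t: "vstep n t" "(LINT x|M. norm (s i x - t x)) < e / 2"
    using lim.IH[of "e / 2" i] lim.prems by auto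
  have "norm (f x - t x) \<le> norm (f x - s i x) + norm (s i x - t x)" for x
    using norm_triangle_ineq[of "f x - s i x" "s i x - t x"] by simp
  then have "(LINT x|M. norm (f x - t x)) \<le> (LINT x|M. norm (f x - s i x) + norm (s i x - t x))"
    using lim.hyps(1,4) integrable_vstep[OF t(1)] by (intro integral_mono) auto
  also have "\<dots> < e" using i t lim.hyps integrable_vstep[OF t(1)] by simp
  finally show ?case using t(1) by blast
qed

lemma correction_on_dense_open:
  assumes f: "integrable M f" and op: "openin (top_of_set {0..1}) G" and dns: "{0..1} \<subseteq> closure G"
  shows "\<exists>g :: real \<Rightarrow> complex. integrable M g \<and>
    (AE x in M. convergent (\<lambda>m. S g m x)) \<and> {x \<in> {0..1}. g x \<noteq> f x} \<subseteq> G"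
proof -
  interpret finite_measure M by (rule finite_M)
  define Q where "Q k g u N F \<longleftrightarrow> vstep N u \<and> (\<forall>x\<in>{0..<1}. x \<notin> G \<longrightarrow> u x = g x) \<and>
      (LINT x|M. norm (u x)) \<le> 8 * (LINT x|M. norm (g x)) \<and> F \<in> sets M \<and> measure M F \<le> (1 / 2) ^ k \<and>
      (\<forall>x\<in>{0..<1}. x \<notin> F \<longrightarrow> (\<forall>m. norm (S u m x) \<le> (1 / 2) ^ k))"
    for k :: nat and g u N F
  have "\<exists>d>0. \<forall>n g. vstep n g \<longrightarrow> (LINT x|M. norm (g x)) \<le> d \<longrightarrow> (\<exists>u N F. Q k g u N F)" for k
    unfolding Q_def by (rule uniform_correction[OF _ dense_open_selects[OF op dns]]) simp
  then obtain d where d: "\<And>k. 0 < d k"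
    and corr: "\<And>k n g. vstep n g \<Longrightarrow> (LINT x|M. norm (g x)) \<le> d k \<Longrightarrow> \<exists>u N F. Q k g u N F" by metis
  \<comment> \<open>\<open>h k\<close> is controlled by \<open>b (Suc k) + b k\<close> and must stay
    below \<open>d k\<close>, so each \<open>b\<close> respects the current and the preceding
    threshold; at \<open>k = 0\<close> truncated subtraction makes both \<open>d 0\<close>. The
    power of \<open>1 / 4\<close> gives summability and leaves room for Markov's inequality.\<close>
  define b where "b k = min ((1 / 4) ^ k) (min (d k / 2) (d (k - 1) / 2))" for k
  have b: "0 < b k" for k using d by (simp add: b_def)
  have "\<exists>n s. vstep n s \<and> (LINT x|M. norm (f x - s x)) < b k" for k by (rule vstep_dense[OF f b])
  then obtain n s where s: "\<And>k. vstep (n k) (s k)" and fs: "\<And>k. (LINT x|M. norm (f x - s k x)) < b k" by metis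
  have ints: "integrable M (s k)" for k by (rule integrable_vstep[OF s])
  define h where "h k x = s (Suc k) x - s k x" for k x
  have h: "vstep (max (n (Suc k)) (n k)) (h k)" for k
    unfolding h_def by (rule vstep_comp2[OF vstep_mono[OF s] vstep_mono[OF s]]) auto
  have h_le: "(LINT x|M. norm (h k x)) \<le> b (Suc k) + b k" for k
  proof -
    have "(LINT x|M. norm (h k x)) \<le> (LINT x|M. norm (f x - s (Suc k) x) + norm (f x - s k x))"
    proof (rule integral_mono)
      show "norm (h k x) \<le> norm (f x - s (Suc k) x) + norm (f x - s k x)" for x
        using norm_triangle_ineq4[of "f x - s k x" "f x - s (Suc k) x"] by (simp add: h_def)
    qed (use f ints integrable_vstep[OF h] in auto)
    also have "\<dots> = (LINT x|M. norm (f x - s (Suc k) x)) + (LINT x|M. norm (f x - s k x))"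
      using f ints by simp
    finally show ?thesis using fs[of k] fs[of "Suc k"] by linarith
  qed
  have "(LINT x|M. norm (h k x)) \<le> d k" for k
  proof -
    have "b (Suc k) \<le> d k / 2" "b k \<le> d k / 2" by (auto simp: b_def)
    then show ?thesis using h_le[of k] by linarith
  qed
  from corr[OF h this] obtain u N F where Q: "\<And>k. Q k (h k) (u k) (N k) (F k)" by metis
  have u: "vstep (N k) (u k)" and u_int: "(LINT x|M. norm (u k x)) \<le> 8 * (LINT x|M. norm (h k x))"
    and F: "F k \<in> sets M" "measure M (F k) \<le> (1 / 2) ^ k" for k
    using Q[of k] unfolding Q_def by blast+
  have uG: "u k x = h k x" if "x \<in> {0..<1}" "x \<notin> G" for k x
    using Q[of k] that unfolding Q_def by blast
  have uS: "norm (S (u k) m x) \<le> (1 / 2) ^ k" if "x \<in> {0..<1}" "x \<notin> F k" for k x m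
    using Q[of k] that unfolding Q_def by blast
  have iu: "integrable M (u k)" for k by (rule integrable_vstep[OF u])
  have sum_half: "summable (\<lambda>k. (1 / 2 :: real) ^ k)" by (intro summable_geometric) simp
  have fin: "emeasure M X < \<infinity>" for X by (simp add: top.not_eq_extremum[symmetric])
  have u_sum: "summable (\<lambda>k. LINT x|M. norm (u k x))"
  proof (rule summable_comparison_test)
    show "summable (\<lambda>k. 16 * (1 / 4 :: real) ^ k)" by (intro summable_mult summable_geometric) simp
    \<comment> \<open>The norm is at most \<open>8 * (b (Suc k) + b k)\<close>, and both terms are
      at most \<open>(1 / 4) ^ k\<close>.\<close>
    have "norm (LINT x|M. norm (u k x)) \<le> 16 * (1 / 4) ^ k" for k
    proof -
      have "b (Suc k) \<le> (1 / 4) ^ Suc k" "b k \<le> (1 / 4) ^ k" by (auto simp only: b_def min.cobounded1)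
      moreover have "(1 / 4 :: real) ^ Suc k \<le> (1 / 4) ^ k" by simp
      ultimately have "(LINT x|M. norm (u k x)) \<le> 16 * (1 / 4) ^ k" using u_int[of k] h_le[of k] by linarith
      then show ?thesis by simp
    qed
    then show "\<exists>K. \<forall>k\<ge>K. norm (LINT x|M. norm (u k x)) \<le> 16 * (1 / 4) ^ k" by blast
  qed
  \<comment> \<open>Markov's inequality bounds these sets by \<open>(1 / 2) ^ k\<close>, like the
    \<open>F k\<close>. By Borel-Cantelli almost every point lies in only finitely many sets of
    either kind.\<close>
  define A where "A k = {x \<in> space M. (1 / 2) ^ k \<le> norm (f x - s k x)}" for k
  have ifs: "integrable M (\<lambda>x. norm (f x - s k x))" for k using f ints by simp
  have A: "A k \<in> sets M" for k unfolding A_def using borel_measurable_integrable[OF ifs[of k]] by measurable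
  have mA: "measure M (A k) \<le> (1 / 2) ^ k" for k
  proof -
    have "measure M (A k) \<le> (LINT x|M. norm (f x - s k x)) / (1 / 2) ^ k"
      unfolding A_def by (rule integral_Markov_inequality_measure[OF ifs sets.empty_sets]) auto
    also have "\<dots> \<le> (1 / 4) ^ k / (1 / 2) ^ k"
      using fs[of k] by (intro divide_right_mono) (auto simp: b_def)
    also have "\<dots> = (1 / 2) ^ k" by (simp add: power_divide[symmetric])
    finally show ?thesis .
  qed
  have "AE x in M. \<forall>\<^sub>F k in sequentially. x \<in> space M - F k"
    using sum_half F(2) by (intro borel_cantelli_AE1 F(1) fin summable_comparison_test[OF _ sum_half]) auto
  moreover have "AE x in M. \<forall>\<^sub>F k in sequentially. x \<in> space M - A k"
    using sum_half mA by (intro borel_cantelli_AE1 A fin summable_comparison_test[OF _ sum_half]) auto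
  ultimately have good: "AE x in M. x \<in> {0..<1} \<and> (\<forall>\<^sub>F k in sequentially. x \<notin> F k) \<and>
      (\<forall>\<^sub>F k in sequentially. norm (f x - s k x) \<le> (1 / 2) ^ k)"
    using AE_M_unit
  proof eventually_elim
    case (elim x)
    have "\<forall>\<^sub>F k in sequentially. x \<notin> F k" using elim(1) by eventually_elim auto
    moreover have "\<forall>\<^sub>F k in sequentially. norm (f x - s k x) \<le> (1 / 2) ^ k"
      using elim(2) by eventually_elim (auto simp: A_def)
    ultimately show ?case using elim(3) by blast
  qed
  \<comment> \<open>The value \<open>u k x\<close> is a partial sum of \<open>u k\<close>, so
    control of the partial sums also yields absolute convergence of the series itself.\<close>
  have u_bd: "\<forall>\<^sub>F k in sequentially. norm (u k x) \<le> (1 / 2) ^ k"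
    if "x \<in> {0..<1}" "\<forall>\<^sub>F k in sequentially. x \<notin> F k" for x
    using that(2)
  proof eventually_elim
    case (elim k)
    then show ?case using uS[OF that(1), of k "P (N k)"] S_P_vstep[OF u that(1)] by simp
  qed
  have summ: "summable (\<lambda>k. norm (u k x))" if "x \<in> {0..<1}" "\<forall>\<^sub>F k in sequentially. x \<notin> F k" for x
    using u_bd[OF that] by (intro summable_comparison_test_ev[OF _ sum_half]) simp
  have AE_summ: "AE x in M. summable (\<lambda>k. norm (u k x))"
    using good by eventually_elim (blast intro: summ)
  define g0 where "g0 x = s 0 x + (\<Sum>k. u k x)" for x
  have iU: "integrable M (\<lambda>x. \<Sum>k. u k x)" by (rule integrable_suminf[OF iu AE_summ u_sum])
  have ig0: "integrable M g0" unfolding g0_def using ints iU by simp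
  \<comment> \<open>The norms of the \<open>u k\<close> are summable, so sum and integral may be
    interchanged.\<close>
  have coeff_U: "(\<lambda>k. coeff (u k) a) sums coeff (\<lambda>x. \<Sum>k. u k x) a" for a
  proof -
    have iuw: "integrable M (\<lambda>x. u k x * cnj (w a x))" for k by (rule integrable_mult_cnj_w[OF iu])
    have sw: "AE x in M. summable (\<lambda>k. norm (u k x * cnj (w a x)))" using AE_summ by (simp add: norm_mult)
    have uw: "summable (\<lambda>k. LINT x|M. norm (u k x * cnj (w a x)))" using u_sum by (simp add: norm_mult)
    have "coeff (\<lambda>x. \<Sum>k. u k x) a = (LINT x|M. (\<Sum>k. u k x * cnj (w a x)))"
      unfolding vilenkin_coeff_def
    proof (rule integral_cong_AE)
      show "AE x in M. (\<Sum>k. u k x) * cnj (w a x) = (\<Sum>k. u k x * cnj (w a x))"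
        using AE_summ by eventually_elim (rule suminf_mult2[OF summable_norm_cancel])
    qed (use integrable_mult_cnj_w[OF iU] integrable_suminf[OF iuw sw uw] in auto)
    then show ?thesis using sums_integral[OF iuw sw uw] by (simp add: vilenkin_coeff_def)
  qed
  have S_g0: "S g0 m x = S (s 0) m x + (\<Sum>k. S (u k) m x)" for m x
  proof -
    have "(\<lambda>k. S (u k) m x) sums S (\<lambda>x. \<Sum>k. u k x) m x"
      unfolding vilenkin_partial_sum_def by (intro sums_sum sums_mult2 coeff_U)
    then show ?thesis unfolding g0_def using S_add[OF ints iU] by (simp add: sums_iff)
  qed
  have conv: "AE x in M. convergent (\<lambda>m. S g0 m x)"
    using good
  proof eventually_elim
    case (elim x)
    \<comment> \<open>For fixed \<open>k\<close> the partial sums are eventually constant in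
      \<open>m\<close>. For large \<open>k\<close> they are at most \<open>(1 / 2) ^ k\<close>
      uniformly in \<open>m\<close>, so Tannery's theorem allows the limit in \<open>m\<close> under
      the sum over \<open>k\<close>.\<close>
    have lim: "(\<lambda>m. S (u k) m x) \<longlonglongrightarrow> u k x" for k
      by (rule tendsto_eventually) (use S_vstep[OF u[of k]] elim in \<open>auto simp: eventually_sequentially\<close>)
    have "\<forall>\<^sub>F k in sequentially. \<forall>m. norm (S (u k) m x) \<le> (1 / 2) ^ k"
      using conjunct1[OF conjunct2[OF elim]] by eventually_elim (use uS elim in blast)
    then have "\<forall>\<^sub>F (k, m) in sequentially \<times>\<^sub>F sequentially. \<forall>m. norm (S (u k) m x) \<le> (1 / 2) ^ k"
      by (subst eventually_prod1) auto
    then have "\<forall>\<^sub>F (k, m) in sequentially \<times>\<^sub>F sequentially. norm (S (u k) m x) \<le> (1 / 2) ^ k"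
      by (rule eventually_mono) auto
    from tannerys_theorem[OF lim this sum_half]
    have "(\<lambda>m. \<Sum>k. S (u k) m x) \<longlonglongrightarrow> (\<Sum>k. u k x)" by simp
    moreover have "(\<lambda>m. S (s 0) m x) \<longlonglongrightarrow> s 0 x"
      by (rule tendsto_eventually) (use S_vstep[OF s[of 0]] elim in \<open>auto simp: eventually_sequentially\<close>)
    ultimately have "(\<lambda>m. S g0 m x) \<longlonglongrightarrow> s 0 x + (\<Sum>k. u k x)"
      unfolding S_g0 by (intro tendsto_add)
    then show ?case by (rule convergentI)
  qed
  have g0_f: "AE x in M. x \<notin> G \<longrightarrow> g0 x = f x"
    using good
  proof eventually_elim
    case (elim x)
    show ?case
    proof
      assume "x \<notin> G"
      have "(\<lambda>k. f x - s k x) \<longlonglongrightarrow> 0"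
        by (rule Lim_null_comparison[OF conjunct2[OF conjunct2[OF elim]]]) (rule LIMSEQ_power_zero, simp)
      then have "(\<lambda>k. s k x) \<longlonglongrightarrow> f x" using tendsto_diff[of "\<lambda>_. f x" "f x" _ "\<lambda>k. f x - s k x" 0] by simp
      \<comment> \<open>Off \<open>G\<close> the corrected \<open>u k\<close> are still the
        differences \<open>h k\<close>, and their sum telescopes back to \<open>f\<close>.\<close>
      then have "(\<lambda>k. h k x) sums (f x - s 0 x)" unfolding h_def by (rule telescope_sums)
      moreover have "u k x = h k x" for k using uG \<open>x \<notin> G\<close> elim by blast
      ultimately have "(\<lambda>k. u k x) sums (f x - s 0 x)" by simp
      then show "g0 x = f x" by (simp add: g0_def sums_iff)
    qed
  qed
  \<comment> \<open>\<open>g0\<close> equals \<open>f\<close> only almost everywhere off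
    \<open>G\<close>. Restoring \<open>f\<close> at every point off \<open>G\<close> changes a null
    set, hence no coefficient, and makes the inclusion hold without exceptions.\<close>
  define g where "g x = (if x \<in> G then g0 x else f x)" for x
  have "G \<in> sets M"
    using op by (auto simp: openin_open sets_restrict_space_iff)
  then have gm: "g \<in> borel_measurable M"
    unfolding g_def using ig0 f by (intro measurable_If_set) auto
  have g_g0: "AE x in M. g0 x = g x" using g0_f by eventually_elim (simp add: g_def)
  have ig: "integrable M g" by (rule integrable_cong_AE_imp[OF ig0 gm g_g0])
  have "coeff g a = coeff g0 a" for a
    unfolding vilenkin_coeff_def
  proof (rule integral_cong_AE)
    show "AE x in M. g x * cnj (w a x) = g0 x * cnj (w a x)" using g_g0 by eventually_elim simp
  qed (use integrable_mult_cnj_w[OF ig] integrable_mult_cnj_w[OF ig0] in auto)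
  then have "S g m x = S g0 m x" for m x by (simp add: vilenkin_partial_sum_def)
  then have "AE x in M. convergent (\<lambda>m. S g m x)" using conv by simp
  then show ?thesis using ig by (intro exI[of _ g]) (auto simp: g_def)
qed

end

theorem corollary1:
  fixes p :: "nat \<Rightarrow> nat" and f :: "real \<Rightarrow> complex" and G :: "real set"
  assumes "bounded_type p"
    and "integrable (lebesgue_on {0..1}) f"
    and "openin (top_of_set {0..1}) G"
    and "{0..1} \<subseteq> closure G"
  shows "\<exists>g :: real \<Rightarrow> complex.
    integrable (lebesgue_on {0..1}) g \<and>
    (AE x in lebesgue_on {0..1}. convergent (\<lambda>m. vilenkin_partial_sum p g m x)) \<and>
    {x \<in> {0..1}. g x \<noteq> f x} \<subseteq> G"
proof -
  obtain B where "vilenkin_system p B"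
    using assms(1) by (auto simp: bounded_type_def vilenkin_system_def)
  then show ?thesis using assms(2-4) by (rule vilenkin_system.correction_on_dense_open)
qed

end
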